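(* There is a randomized algorithm with one-sided error which, given two families $A, B$ of subsets of $\{1,\ldots,d\}$ with $|A| = |B| = n$, decides whether there exist $a \in A$ and $b \in B$ with $a \cap b = \emptyset$. It runs in time $\tilde{\mathcal{O}}(1.25^d \cdot n)$ and succeeds with probability $1 - 2^{-d^{\Omega(1)}}$.
   Context: The Orthogonal Vectors problem: given two families $A, B$ of subsets of $\{1,\ldots,d\}$, each of size $n$, decide whether there exist $a\in A$, $b\in B$ with $a\cap b=\emptyset$. Throughout, $d = c\log n$ for some constant $c>0$. The notation $\tilde{\mathcal{O}}(\cdot)$ hides polylogarithmic factors in $n$, and hence also factors polynomial in $d$. One-sided error means the algorithm never reports an orthogonal pair when none exists. If an orthogonal pair exists, it reports one with the stated probability. *)

theory Defs
  imports "HOL-Probability.Probability" "HOL-Library.Landau_Symbols" "HOL-Library.Log_Nat"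
begin

section \<open>Randomized random access machines\<close>

text \<open>
  Algorithms are finite programs for a RAM over the natural numbers with indirect addressing,
  the four AHU arithmetic operations and a coin-flipping instruction.  Memory is a family of
  unbounded arrays; array names are literals, so that a program only uses a fixed finite number of
  them, while indices are computed.

  Time is measured by the logarithmic cost criterion: every value that occurs during a computation,
  including every address, is charged its binary length.  Unit cost would be unsound here, since
  numbers of unbounded length could be manipulated in one step.  On computations all of whose
  numbers have \<open>O(log n)\<close> bits, logarithmic cost and unit cost differ by a factor \<open>O(log n)\<close>.
\<close>

type_synonym store = "nat \<Rightarrow> nat \<Rightarrow> nat"

datatype binop = Plus | Minus | Times | Divide

datatype exp =
    Const nat
  | Load nat exp
  | Bin binop exp exp

datatype prog =
    Skip
  | Assign nat exp exp        \<comment> \<open>array name, index, value\<close>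
  | Flip nat exp              \<comment> \<open>array name, index\<close>
  | Seq prog prog
  | If exp prog prog
  | While exp prog

text \<open>Subtraction is truncated and division is integer division with \<open>x div 0 = 0\<close>.\<close>

fun binop_val :: "binop \<Rightarrow> nat \<Rightarrow> nat \<Rightarrow> nat" where
  "binop_val Plus x y = x + y"
| "binop_val Minus x y = x - y"
| "binop_val Times x y = x * y"
| "binop_val Divide x y = x div y"

fun exp_val :: "exp \<Rightarrow> store \<Rightarrow> nat" where
  "exp_val (Const k) s = k"
| "exp_val (Load x e) s = s x (exp_val e s)"
| "exp_val (Bin f e1 e2) s = binop_val f (exp_val e1 s) (exp_val e2 s)"

definition size_of_nat :: "nat \<Rightarrow> nat" where
  "size_of_nat k = 1 + floorlog 2 k"

fun exp_cost :: "exp \<Rightarrow> store \<Rightarrow> nat" where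
  "exp_cost (Const k) s = size_of_nat k"
| "exp_cost (Load x e) s = exp_cost e s + size_of_nat (exp_val (Load x e) s)"
| "exp_cost (Bin f e1 e2) s =
     exp_cost e1 s + exp_cost e2 s + size_of_nat (exp_val (Bin f e1 e2) s)"

definition store_upd :: "store \<Rightarrow> nat \<Rightarrow> nat \<Rightarrow> nat \<Rightarrow> store" where
  "store_upd s x i v = s(x := (s x)(i := v))"

text \<open>
  \<open>exec \<omega> P (s, p) t (s', p')\<close>: run with coin sequence \<open>\<omega>\<close>, of which the first \<open>p\<close> coins have already
  been used, \<open>P\<close> started in store \<open>s\<close> halts in store \<open>s'\<close> at cost \<open>t\<close>, with \<open>p'\<close> coins used by then.
\<close>

inductive exec :: "(nat \<Rightarrow> bool) \<Rightarrow> prog \<Rightarrow> store \<times> nat \<Rightarrow> nat \<Rightarrow> store \<times> nat \<Rightarrow> bool"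
  for \<omega> :: "nat \<Rightarrow> bool" where
  exec_Skip: "exec \<omega> Skip (s, p) 1 (s, p)"
| exec_Assign:
    "exec \<omega> (Assign x i e) (s, p) (exp_cost i s + exp_cost e s)
       (store_upd s x (exp_val i s) (exp_val e s), p)"
| exec_Flip:
    "exec \<omega> (Flip x i) (s, p) (exp_cost i s + 1)
       (store_upd s x (exp_val i s) (of_bool (\<omega> p)), Suc p)"
| exec_Seq:
    "exec \<omega> P u t1 v \<Longrightarrow> exec \<omega> Q v t2 w \<Longrightarrow> exec \<omega> (Seq P Q) u (t1 + t2) w"
| exec_If_True:
    "exp_val e s \<noteq> 0 \<Longrightarrow> exec \<omega> P (s, p) t v \<Longrightarrow>
       exec \<omega> (If e P Q) (s, p) (exp_cost e s + t) v"
| exec_If_False: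
    "exp_val e s = 0 \<Longrightarrow> exec \<omega> Q (s, p) t v \<Longrightarrow>
       exec \<omega> (If e P Q) (s, p) (exp_cost e s + t) v"
| exec_While_False:
    "exp_val e s = 0 \<Longrightarrow> exec \<omega> (While e P) (s, p) (exp_cost e s) (s, p)"
| exec_While_True:
    "exp_val e s \<noteq> 0 \<Longrightarrow> exec \<omega> P (s, p) t1 v \<Longrightarrow> exec \<omega> (While e P) v t2 w \<Longrightarrow>
       exec \<omega> (While e P) (s, p) (exp_cost e s + t1 + t2) w"

lemma exec_deterministic:
  "exec \<omega> P u t v \<Longrightarrow> exec \<omega> P u t' v' \<Longrightarrow> t' = t \<and> v' = v"
proof (induction arbitrary: t' v' rule: exec.induct)
  case (exec_Skip s p)
  then show ?case by cases auto
next
  case (exec_Assign x i e s p)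
  then show ?case by cases auto
next
  case (exec_Flip x i s p)
  then show ?case by cases auto
next
  case (exec_Seq P u t1 v Q t2 w)
  from exec_Seq.prems obtain r1 r2 x
    where "exec \<omega> P u r1 x" "exec \<omega> Q x r2 v'" "t' = r1 + r2"
    by cases auto
  with exec_Seq.IH show ?case by metis
next
  case (exec_If_True e s P p t v Q)
  from exec_If_True.prems exec_If_True.hyps(1) obtain r
    where "exec \<omega> P (s, p) r v'" "t' = exp_cost e s + r"
    by cases auto
  with exec_If_True.IH show ?case by metis
next
  case (exec_If_False e s Q p t v P)
  from exec_If_False.prems exec_If_False.hyps(1) obtain r
    where "exec \<omega> Q (s, p) r v'" "t' = exp_cost e s + r"
    by cases auto
  with exec_If_False.IH show ?case by metis
next
  case (exec_While_False e s P p)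
  from exec_While_False.prems exec_While_False.hyps show ?case
    by cases auto
next
  case (exec_While_True e s P p t1 v t2 w)
  from exec_While_True.prems exec_While_True.hyps(1) obtain r1 r2 x
    where "exec \<omega> P (s, p) r1 x" "exec \<omega> (While e P) x r2 v'" "t' = exp_cost e s + r1 + r2"
    by cases auto
  with exec_While_True.IH show ?case by metis
qed

definition coins :: "(nat \<Rightarrow> bool) measure" where
  "coins = Pi\<^sub>M UNIV (\<lambda>_. measure_pmf (bernoulli_pmf (1 / 2)))"


section \<open>Orthogonal Vectors\<close>

text \<open>
  A family is a list, so repeated members are allowed.
\<close>

definition OV_instance :: "nat \<Rightarrow> nat \<Rightarrow> nat set list \<Rightarrow> nat set list \<Rightarrow> bool" where
  "OV_instance n d A B \<longleftrightarrow>
     length A = n \<and> length B = n \<and> (\<forall>a \<in> set A. a \<subseteq> {1..d}) \<and> (\<forall>b \<in> set B. b \<subseteq> {1..d})"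

definition has_orthogonal_pair :: "nat set list \<Rightarrow> nat set list \<Rightarrow> bool" where
  "has_orthogonal_pair A B \<longleftrightarrow> (\<exists>a \<in> set A. \<exists>b \<in> set B. a \<inter> b = {})"

definition orthogonal_pair :: "nat set list \<Rightarrow> nat set list \<Rightarrow> nat \<times> nat \<Rightarrow> bool" where
  "orthogonal_pair A B = (\<lambda>(i, j). i < length A \<and> j < length B \<and> A ! i \<inter> B ! j = {})"

text \<open>
  Input: array 0 holds \<open>n\<close> and \<open>d\<close>, arrays 1 and 2 hold the \<open>n \<times> d\<close> characteristic 0/1-matrices of
  \<open>A\<close> and \<open>B\<close> in row-major order; all other cells are 0.
\<close>

definition char_matrix :: "nat \<Rightarrow> nat \<Rightarrow> nat set list \<Rightarrow> nat \<Rightarrow> nat" where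
  "char_matrix n d A k = of_bool (k < n * d \<and> Suc (k mod d) \<in> A ! (k div d))"

definition OV_input :: "nat \<Rightarrow> nat \<Rightarrow> nat set list \<Rightarrow> nat set list \<Rightarrow> store" where
  "OV_input n d A B = (\<lambda>_ _. 0)
     (0 := (\<lambda>_. 0)(0 := n, 1 := d), 1 := char_matrix n d A, 2 := char_matrix n d B)"

text \<open>
  Output, in array 3: cell 0 is the answer (0 for ``no orthogonal pair found''); if it is nonzero,
  cells 1 and 2 are the positions, counted from 0, of the reported pair in \<open>A\<close> and \<open>B\<close>.
\<close>

definition OV_output :: "store \<Rightarrow> (nat \<times> nat) option" where
  "OV_output s = (if s 3 0 = 0 then None else Some (s 3 1, s 3 2))"

definition OV_run ::
  "prog \<Rightarrow> (nat \<Rightarrow> bool) \<Rightarrow> nat \<Rightarrow> nat \<Rightarrow> nat set list \<Rightarrow> nat set list \<Rightarrow> nat \<Rightarrow> (nat \<times> nat) option \<Rightarrow> bool"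
  where
  "OV_run P \<omega> n d A B t out \<longleftrightarrow>
     (\<exists>s p. exec \<omega> P (OV_input n d A B, 0) t (s, p) \<and> out = OV_output s)"


section \<open>Asymptotics\<close>

definition soft_O :: "(nat \<Rightarrow> real) \<Rightarrow> (nat \<Rightarrow> real) set" where
  "soft_O g = {f. \<exists>k::nat. f \<in> O(\<lambda>n. g n * ln (real n) ^ k)}"

text \<open>\<open>d = c log n\<close>, where \<open>c log n\<close> may be rounded up or down to an integer.\<close>

definition dimension_c_log :: "real \<Rightarrow> (nat \<Rightarrow> nat) \<Rightarrow> bool" where
  "dimension_c_log c d \<longleftrightarrow> (\<forall>n>0. \<bar>real (d n) - c * log 2 (real n)\<bar> < 1)"

end

theory Submission
  imports Defs "HOL-Real_Asymp.Real_Asymp"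
begin

text \<open>
  The algorithm is deterministic; the coins are never used.  For a suitable constant \<open>K\<close> the
  disjointness relation on subsets of \<open>{0..<K}\<close> is written as ``\<open>a\<close> and \<open>b\<close> share a key'', where each
  set carries at most \<open>1.25 ^ K\<close> keys.  A key is a set \<open>S\<close> with \<open>a \<subseteq> S\<close> and \<open>S \<inter> b = {}\<close>, together
  with the cardinalities of \<open>a\<close> and \<open>b\<close>, and \<open>S\<close> is taken from a random family of sets whose common
  size depends on these cardinalities.  For balanced cardinalities the best size leaves about
  \<open>(4/3) ^ (K/2) = 1.155 ^ K\<close> keys per set; the slack up to 1.25 absorbs polynomial factors in \<open>K\<close>.
  Cutting \<open>{1..d}\<close> into blocks of length \<open>K\<close> and concatenating one key per block gives every member
  of the families at most about \<open>1.25 ^ d\<close> keys of \<open>O(d)\<close> bits.  The keys of \<open>A\<close> are entered into a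
  directly addressed table, in which the keys of \<open>B\<close> are then looked up.  The key table for a single
  block is a constant of the program.
\<close>

section \<open>Keys for disjointness on a block\<close>

text \<open>Random sets serve only to prove that a key table exists. \<open>K\<close> depends on
  none of \<open>c\<close>, \<open>n\<close> and \<open>d\<close>, so one table can be written into
  one program that works for every \<open>c\<close>, and its size is a constant factor; this is how
  the randomness disappears. \<open>K\<close> must be fixed but large: a polynomial loss in
  \<open>K\<close> per block is raised to the power \<open>d / K\<close>, so it has to fit below
  \<open>1.25 ^ K\<close> inside each block. The tight case is that of unbalanced cardinalities: at
  the threshold difference the bound on the keys per set is about
  \<open>(4/3) ^ (17 * K / 22)\<close>, roughly \<open>1.249 ^ K\<close>, and only the thin
  remaining margin pays for the polynomial. A block of a member of \<open>A\<close> carries no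
  information on the cardinality of its partner, so it needs keys for each of the
  \<open>K + 1\<close> possible values, and likewise on the side of \<open>B\<close>. Keys are
  packed into integers because a table address of \<open>O(d)\<close> bits costs only
  \<open>O(log n)\<close> under logarithmic cost when \<open>d = c log n\<close>.\<close>

lemma exists_list_le_average:
  fixes g :: "'j \<Rightarrow> 's \<Rightarrow> real" and c :: "'j \<Rightarrow> real"
  assumes "finite M" "M \<noteq> {}"
  shows "\<exists>xs. set xs \<subseteq> M \<and> length xs = N \<and>
    (\<Sum>j\<in>J. c j * prod_list (map (g j) xs)) \<le> (\<Sum>j\<in>J. c j * (sum (g j) M / card M) ^ N)"
proof (induction N arbitrary: c)
  case 0
  then show ?case by simp
next
  case (Suc N)
  define \<mu> where "\<mu> j = sum (g j) M / card M" for j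
  \<comment> \<open>Method of conditional expectations: \<open>h x\<close> is the expected weighted
    sum when the first entry is \<open>x\<close> and the other \<open>N\<close> entries are uniform
    and independent. Some \<open>x\<close> is at most the average; its factor is then absorbed into
    the weights \<open>c\<close> for the remaining entries.\<close>
  define h where "h x = (\<Sum>j\<in>J. c j * \<mu> j ^ N * g j x)" for x
  have "\<exists>x\<in>M. h x \<le> sum h M / card M"
  proof (rule ccontr)
    assume "\<not> ?thesis"
    then have "(\<Sum>x\<in>M. sum h M / card M) < sum h M"
      using assms by (intro sum_strict_mono) (auto simp: not_le)
    then show False using assms by simp
  qed
  moreover have "sum h M / card M = (\<Sum>j\<in>J. c j * \<mu> j ^ Suc N)"
  proof -
    have "sum h M = (\<Sum>j\<in>J. c j * \<mu> j ^ N * sum (g j) M)"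
      unfolding h_def by (subst sum.swap) (simp add: sum_distrib_left)
    then show ?thesis
      by (subst \<open>sum h M = _\<close>, subst sum_divide_distrib)
        (intro sum.cong refl, simp add: \<mu>_def)
  qed
  ultimately obtain x where x: "x \<in> M" "h x \<le> (\<Sum>j\<in>J. c j * \<mu> j ^ Suc N)" by auto
  from Suc[of "\<lambda>j. c j * g j x"] obtain xs where
    "set xs \<subseteq> M" "length xs = N"
    "(\<Sum>j\<in>J. c j * g j x * prod_list (map (g j) xs)) \<le> (\<Sum>j\<in>J. c j * g j x * \<mu> j ^ N)"
    unfolding \<mu>_def by blast
  with x show ?case
    by (intro exI[of _ "x # xs"]) (simp add: h_def \<mu>_def mult_ac)
qed

section \<open>Random families of separating sets\<close>

lemma card_subsets_between:
  assumes "finite X" "a \<subseteq> X" "card a \<le> s"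
  shows "card {S. a \<subseteq> S \<and> S \<subseteq> X \<and> card S = s} = (card X - card a) choose (s - card a)"
proof -
  have fa: "finite a" using assms finite_subset by blast
  have "bij_betw (\<lambda>B. B \<union> a) {B. B \<subseteq> X - a \<and> card B = s - card a} {S. a \<subseteq> S \<and> S \<subseteq> X \<and> card S = s}"
  proof (rule bij_betw_byWitness[where f' = "\<lambda>S. S - a"])
    show "(\<lambda>B. B \<union> a) ` {B. B \<subseteq> X - a \<and> card B = s - card a} \<subseteq> {S. a \<subseteq> S \<and> S \<subseteq> X \<and> card S = s}"
    proof safe
      fix B assume B: "B \<subseteq> X - a" "card B = s - card a"
      then have "finite B" "B \<inter> a = {}" using assms(1) finite_subset by blast+
      then show "card (B \<union> a) = s" using B fa assms by (simp add: card_Un_disjoint)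
    qed (use assms in auto)
  qed (use fa in \<open>auto simp: card_Diff_subset\<close>)
  then have "card {S. a \<subseteq> S \<and> S \<subseteq> X \<and> card S = s} = card {B. B \<subseteq> X - a \<and> card B = s - card a}"
    by (simp add: bij_betw_same_card)
  also have "\<dots> = (card X - card a) choose (s - card a)"
    using assms fa by (simp add: n_subsets card_Diff_subset)
  finally show ?thesis .
qed

text \<open>Converts the estimate \<open>(1 + q) ^ N \<le> exp (q * N)\<close> into a power of 2
  that can be weighed against \<open>2 ^ T\<close>; the crude \<open>e \<le> 4\<close>
  suffices.\<close>

lemma exp_le_four_powr: "0 \<le> y \<Longrightarrow> exp y \<le> (2::real) powr (2 * y)"
proof -
  assume y: "0 \<le> y"
  have "exp (1::real) \<le> 4" using exp_le by linarith
  then have "exp 1 powr y \<le> (4::real) powr y" using y by (intro powr_mono2) auto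
  also have "(4::real) powr y = (2 powr 2) powr y" by simp
  also have "\<dots> = 2 powr (2 * y)" by (simp only: powr_powr)
  finally show ?thesis by (simp add: powr_def)
qed

text \<open>Makes \<open>2 ^ degree\<close> multiplicative along the list of drawn sets, so that its
  average over random lists is a power of the average for one draw.\<close>

lemma prod_list_one_plus_of_bool:
  "prod_list (map (\<lambda>x. 1 + of_bool (P x) :: real) xs) = 2 ^ length (filter P xs)"
  by (induction xs) auto

lemma prod_list_of_bool:
  "prod_list (map (\<lambda>x. of_bool (P x) :: real) xs) = of_bool (\<forall>x\<in>set xs. P x)"
  by (induction xs) auto

lemma card_filter_set_le: "card {x \<in> set xs. P x} \<le> length (filter P xs)"
  by (metis card_length set_filter)

text \<open>
  The family consists of \<open>O(K / p)\<close> random sets, where \<open>p\<close> is the probability that one of them separates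
  a given pair.  The averaged potential counts unseparated pairs and adds \<open>2 ^ (degree - T)\<close> for each
  set, so that a value below 1 gives both coverage and degrees at most \<open>T\<close>.
\<close>

lemma separating_family:
  fixes K wa wb s :: nat and r :: real
  assumes K: "2 \<le> K" and s: "wa \<le> s" "s + wb \<le> K" and r: "1 \<le> r"
    and ra: "real ((K - wa) choose (s - wa)) \<le> r * real ((K - wa - wb) choose (s - wa))"
    and rb: "real ((K - wb) choose s) \<le> r * real ((K - wa - wb) choose (s - wa))"
  shows "\<exists>F. finite F \<and>
    (\<forall>a b. a \<subseteq> {..<K} \<and> b \<subseteq> {..<K} \<and> card a = wa \<and> card b = wb \<and> a \<inter> b = {} \<longrightarrow>
       (\<exists>S\<in>F. a \<subseteq> S \<and> S \<inter> b = {})) \<and>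
    (\<forall>a. a \<subseteq> {..<K} \<and> card a = wa \<longrightarrow> real (card {S\<in>F. a \<subseteq> S}) \<le> 10 * K * r) \<and>
    (\<forall>b. b \<subseteq> {..<K} \<and> card b = wb \<longrightarrow> real (card {S\<in>F. S \<inter> b = {}}) \<le> 10 * K * r)"
proof -
  define M where "M = {S. S \<subseteq> {..<K} \<and> card S = s}"
  have finM: "finite M" unfolding M_def by simp
  have cM: "card M = K choose s" unfolding M_def using n_subsets[of "{..<K}" s] by simp
  have cM0: "card M > 0" using s by (simp add: cM)
  then have M0: "M \<noteq> {}" by auto
  define c where "c = (K - wa - wb) choose (s - wa)"
  have c0: "c > 0" unfolding c_def using s by simp
  define p where "p = real c / card M"
  have p0: "p > 0" using c0 cM0 by (simp add: p_def)
  \<comment> \<open>With \<open>3 * K / p\<close> draws a fixed pair stays unseparated with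
    probability at most \<open>exp (- 3 * K) \<le> (1/8) ^ K\<close>, which beats the at most
    \<open>4 ^ K\<close> pairs.\<close>
  define N where "N = nat \<lceil>3 * K / p\<rceil>"
  \<comment> \<open>A set met by one draw with probability \<open>q \<le> r * p\<close> has average
    \<open>2 ^ degree\<close> at most \<open>2 powr (2 * (3 * K * r + 1))\<close>. Hence
    \<open>T\<close> makes the average of \<open>2 ^ (degree - T)\<close> at most
    \<open>(1/2) ^ K / 4\<close>, small enough for \<open>2 ^ K\<close> sets on either side.\<close>
  define T where "T = nat \<lceil>6 * K * r + K + 4\<rceil>"
  have Nl: "3 * K \<le> p * N"
  proof -
    have "3 * K / p \<le> N" unfolding N_def using p0 by (simp add: of_nat_nat)
    then show ?thesis using p0 by (simp add: field_simps)
  qed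
  have Nu: "N \<le> 3 * K / p + 1" unfolding N_def using p0 by (simp add: of_nat_nat)
  have Kr: "real K \<le> K * r" using r by (simp add: mult_le_cancel_left1)
  have Tl: "6 * K * r + K + 4 \<le> T" unfolding T_def by (rule real_nat_ceiling_ge)
  have Tu: "T \<le> 10 * K * r"
  proof -
    have "real T = real_of_int \<lceil>6 * K * r + K + 4\<rceil>"
      unfolding T_def using Kr by (intro of_nat_nat) simp
    then have "T \<le> 6 * K * r + K + 5" by linarith
    also have "\<dots> \<le> 10 * (K * r)" using Kr K by linarith
    also have "\<dots> = 10 * K * r" by simp
    finally show ?thesis .
  qed
  define PA where "PA = {a. a \<subseteq> {..<K} \<and> card a = wa}"
  define PB where "PB = {b. b \<subseteq> {..<K} \<and> card b = wb}"
  define PP where "PP = {(a,b). a \<in> PA \<and> b \<in> PB \<and> a \<inter> b = {}}"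
  have fPA: "finite PA" and fPB: "finite PB" by (simp_all add: PA_def PB_def)
  have kPA: "card PA \<le> 2 ^ K"
    using card_mono[of "Pow {..<K}" PA] by (auto simp: PA_def card_Pow)
  have kPB: "card PB \<le> 2 ^ K"
    using card_mono[of "Pow {..<K}" PB] by (auto simp: PB_def card_Pow)
  have PPs: "PP \<subseteq> PA \<times> PB" by (auto simp: PP_def)
  have fPP: "finite PP" using PPs fPA fPB by (meson finite_SigmaI finite_subset)
  have kPP: "card PP \<le> 2 ^ K * 2 ^ K"
    using card_mono[OF _ PPs] fPA fPB kPA kPB
    by (simp add: card_cartesian_product) (meson le_trans mult_le_mono)
  \<comment> \<open>Factors contributed by one drawn set: along a list they multiply to 1 or 0 for
    an unseparated or separated pair, and to \<open>2 ^ degree\<close> for a single set.\<close>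
  define g :: "(nat set \<times> nat set) + (nat set + nat set) \<Rightarrow> nat set \<Rightarrow> real" where
    "g = case_sum (\<lambda>(a,b) S. of_bool (\<not> (a \<subseteq> S \<and> S \<inter> b = {})))
      (case_sum (\<lambda>a S. 1 + of_bool (a \<subseteq> S)) (\<lambda>b S. 1 + of_bool (S \<inter> b = {})))"
  define w :: "(nat set \<times> nat set) + (nat set + nat set) \<Rightarrow> real" where
    "w = case_sum (\<lambda>_. 1) (\<lambda>_. (1/2) ^ T)"
  define J where "J = PP <+> (PA <+> PB)"
  have fJ: "finite J" unfolding J_def using fPP fPA fPB by simp
  obtain xs where xs: "set xs \<subseteq> M"
    "(\<Sum>j\<in>J. w j * prod_list (map (g j) xs)) \<le> (\<Sum>j\<in>J. w j * (sum (g j) M / card M) ^ N)"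
    using exists_list_le_average[OF finM M0, where N=N and g=g and c=w and J=J] by blast
  have deg: "(1/2) ^ T * ((sum (\<lambda>S. 1 + of_bool (Q S) :: real) M) / card M) ^ N \<le> (1/2) ^ K / 4"
    if Q: "real (card {S\<in>M. Q S}) \<le> r * c" for Q
  proof -
    define q where "q = real (card {S\<in>M. Q S}) / card M"
    have "{S\<in>M. Q S} \<subseteq> M" by auto
    then have q: "0 \<le> q" "q \<le> 1" unfolding q_def using cM0 card_mono[OF finM, of "{S\<in>M. Q S}"]
      by auto
    have qr: "q \<le> r * p" using Q cM0 by (simp add: q_def p_def field_simps)
    have "sum (\<lambda>S. 1 + of_bool (Q S) :: real) M = card M + card {S\<in>M. Q S}"
      using finM by (simp add: sum.distrib) (simp only: Int_def mem_Collect_eq)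
    then have "(sum (\<lambda>S. 1 + of_bool (Q S) :: real) M) / card M = 1 + q"
      using cM0 by (simp add: q_def field_simps)
    moreover have "(1 + q) ^ N \<le> exp q ^ N" using q by (intro power_mono) auto
    moreover have "exp q ^ N = exp (q * N)" using exp_of_nat_mult[of N q] by (simp add: mult.commute)
    moreover have "exp (q * N) \<le> 2 powr (2 * (q * N))" using q by (intro exp_le_four_powr) simp
    moreover have "q * N \<le> 3 * K * r + 1"
    proof -
      have "q * N \<le> q * (3 * K / p + 1)" using Nu q by (intro mult_left_mono) auto
      also have "\<dots> = q * (3 * K / p) + q" by (simp add: algebra_simps)
      also have "q * (3 * K / p) \<le> (r * p) * (3 * K / p)" using qr p0 by (intro mult_right_mono) auto
      also have "\<dots> = 3 * K * r" using p0 by simp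
      finally show ?thesis using q by linarith
    qed
    then have "2 powr (2 * (q * N)) \<le> (2::real) powr (real T - real K - 2)"
      using Tl by (intro powr_mono) auto
    moreover have "(1/2) ^ T * (2::real) powr (real T - real K - 2) = (1/2) ^ K / 4"
      by (simp add: powr_diff powr_realpow power_divide)
    ultimately show ?thesis by (smt (verit) mult_left_mono zero_le_power zero_le_divide_1_iff)
  qed
  have degA: "(1/2) ^ T * ((sum (\<lambda>S. 1 + of_bool (a \<subseteq> S) :: real) M) / card M) ^ N \<le> (1/2) ^ K / 4"
    if "a \<in> PA" for a
  proof (rule deg)
    have "{S\<in>M. a \<subseteq> S} = {S. a \<subseteq> S \<and> S \<subseteq> {..<K} \<and> card S = s}" by (auto simp: M_def)
    then show "real (card {S\<in>M. a \<subseteq> S}) \<le> r * c"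
      using card_subsets_between[of "{..<K}" a s] that s ra by (simp add: PA_def c_def)
  qed
  have degB: "(1/2) ^ T * ((sum (\<lambda>S. 1 + of_bool (S \<inter> b = {}) :: real) M) / card M) ^ N \<le> (1/2) ^ K / 4"
    if "b \<in> PB" for b
  proof (rule deg)
    have fb: "finite b" "b \<subseteq> {..<K}" "card b = wb" using that by (auto simp: PB_def finite_subset)
    have "{S\<in>M. S \<inter> b = {}} = {S. {} \<subseteq> S \<and> S \<subseteq> {..<K} - b \<and> card S = s}" by (auto simp: M_def)
    then show "real (card {S\<in>M. S \<inter> b = {}}) \<le> r * c"
      using card_subsets_between[of "{..<K} - b" "{}" s] fb rb by (simp add: c_def card_Diff_subset)
  qed
  have cov: "((sum (\<lambda>S. of_bool (\<not> (a \<subseteq> S \<and> S \<inter> b = {})) :: real) M) / card M) ^ N \<le> (1/8) ^ K"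
    if "(a, b) \<in> PP" for a b
  proof -
    have ab: "a \<subseteq> {..<K} - b" "card a = wa" "b \<subseteq> {..<K}" "card b = wb" "finite b"
      using that by (auto simp: PP_def PA_def PB_def finite_subset)
    have "{S\<in>M. a \<subseteq> S \<and> S \<inter> b = {}} = {S. a \<subseteq> S \<and> S \<subseteq> {..<K} - b \<and> card S = s}"
      by (auto simp: M_def)
    then have c: "card {S\<in>M. a \<subseteq> S \<and> S \<inter> b = {}} = c"
      using card_subsets_between[of "{..<K} - b" a s] ab s
      by (simp add: c_def card_Diff_subset diff_diff_eq add.commute)
    have "sum (\<lambda>S. of_bool (\<not> (a \<subseteq> S \<and> S \<inter> b = {})) :: real) M
        = sum (\<lambda>S. 1 - of_bool (a \<subseteq> S \<and> S \<inter> b = {}) :: real) M"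
      by (intro sum.cong) auto
    also have "\<dots> = card M - real (card (M \<inter> {S. a \<subseteq> S \<and> S \<inter> b = {}}))"
      unfolding sum_subtractf using finM by simp
    also have "M \<inter> {S. a \<subseteq> S \<and> S \<inter> b = {}} = {S\<in>M. a \<subseteq> S \<and> S \<inter> b = {}}" by blast
    also note c
    finally have avg: "(sum (\<lambda>S. of_bool (\<not> (a \<subseteq> S \<and> S \<inter> b = {})) :: real) M) / card M = 1 - p"
      using cM0 by (simp add: p_def field_simps)
    have "c \<le> card M" unfolding c[symmetric] using finM by (intro card_mono) auto
    then have "p \<le> 1" using cM0 by (simp add: p_def)
    then have "(1 - p) ^ N \<le> exp (-p) ^ N" using exp_ge_add_one_self[of "-p"]
      by (intro power_mono) auto
    moreover have "exp (-p) ^ N = exp (- (p * N))" by (simp add: exp_of_nat_mult[symmetric] mult.commute)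
    moreover have "exp (- (p * N)) \<le> exp (- (3 * real K))" using Nl by simp
    moreover have "exp (- (3 * real K)) = exp (-1) ^ (3 * K)"
      by (simp add: exp_of_nat_mult[symmetric])
    moreover have "exp (-1 :: real) ^ (3 * K) \<le> (1/2) ^ (3 * K)"
    proof (rule power_mono)
      show "exp (-1::real) \<le> 1/2" using exp_ge_add_one_self[of 1]
        by (simp add: exp_minus inverse_eq_divide field_simps)
    qed simp
    moreover have "(1/2::real) ^ (3 * K) = (1/8) ^ K" by (simp add: power_mult power3_eq_cube)
    ultimately have "(1 - p) ^ N \<le> (1/8) ^ K" by linarith
    then show ?thesis unfolding avg .
  qed
  have "(\<Sum>j\<in>J. w j * (sum (g j) M / card M) ^ N)
      \<le> real (card PP) * (1/8) ^ K + (real (card PA) * ((1/2)^K/4) + real (card PB) * ((1/2)^K/4))"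
  proof -
    have 1: "(\<Sum>j\<in>PP. w (Inl j) * (sum (g (Inl j)) M / card M) ^ N) \<le> real (card PP) * (1/8) ^ K"
      using cov by (intro sum_bounded_above) (auto simp: w_def g_def)
    have 2: "(\<Sum>j\<in>PA. w (Inr (Inl j)) * (sum (g (Inr (Inl j))) M / card M) ^ N) \<le> real (card PA) * ((1/2)^K/4)"
      using degA by (intro sum_bounded_above) (auto simp: w_def g_def)
    have 3: "(\<Sum>j\<in>PB. w (Inr (Inr j)) * (sum (g (Inr (Inr j))) M / card M) ^ N) \<le> real (card PB) * ((1/2)^K/4)"
      using degB by (intro sum_bounded_above) (auto simp: w_def g_def)
    show ?thesis unfolding J_def using fPP fPA fPB 1 2 3 by (simp add: sum.Plus o_def)
  qed
  \<comment> \<open>The pairs and the sets of each side contribute at most \<open>1/4\<close> each;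
    for the pairs this is \<open>(1/2) ^ K\<close> with \<open>2 \<le> K\<close>.\<close>
  also have "\<dots> < 1"
  proof -
    have "real (card PP) * (1/8) ^ K \<le> (2 ^ K * 2 ^ K) * (1/8) ^ K"
      using of_nat_mono[OF kPP, where 'a = real] by (intro mult_right_mono) simp_all
    also have "\<dots> = (1/2::real) ^ K" by (simp add: power_mult_distrib[symmetric])
    also have "\<dots> \<le> (1/2) ^ 2" using K by (intro power_decreasing) auto
    finally have "real (card PP) * (1/8) ^ K \<le> 1/4" by (simp add: power2_eq_square)
    moreover have "real (card X) * ((1/2)^K/4) \<le> 1/4" if "card X \<le> 2 ^ K" for X :: "nat set set"
    proof -
      have "real (card X) * ((1/2)^K/4) \<le> 2 ^ K * ((1/2)^K/4)"
        using of_nat_mono[OF that, where 'a = real] by (intro mult_right_mono) simp_all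
      then show ?thesis by (simp add: power_divide)
    qed
    note this[OF kPA] this[OF kPB]
    ultimately show ?thesis by linarith
  qed
  finally have lt1: "(\<Sum>j\<in>J. w j * prod_list (map (g j) xs)) < 1" using xs by linarith
  have pos: "0 \<le> w j * prod_list (map (g j) xs)" for j
  proof -
    have "0 \<le> prod_list (map (g j) xs)"
      by (rule prod_list_nonneg) (auto simp: g_def split: sum.split)
    then show ?thesis by (auto simp: w_def split: sum.split)
  qed
  \<comment> \<open>The summands are nonnegative, so each one is below 1. For a pair the summand is
    0 or 1, hence 0, so some set separates it; for a single set it says that the degree is below
    \<open>T\<close>.\<close>
  have each: "w j * prod_list (map (g j) xs) < 1" if "j \<in> J" for j
    using member_le_sum[of j J "\<lambda>j. w j * prod_list (map (g j) xs)"] pos that fJ lt1 by auto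
  have degT: "length (filter Q xs) \<le> T" if "(1/2) ^ T * (2::real) ^ length (filter Q xs) < 1" for Q
  proof (rule ccontr)
    assume "\<not> ?thesis"
    then have "(2::real) ^ T \<le> 2 ^ length (filter Q xs)" by (intro power_increasing) auto
    then show False using that by (simp add: power_divide field_simps)
  qed
  show ?thesis
  proof (intro exI[of _ "set xs"] conjI allI impI)
    fix a b assume "a \<subseteq> {..<K} \<and> b \<subseteq> {..<K} \<and> card a = wa \<and> card b = wb \<and> a \<inter> b = {}"
    then have "Inl (a, b) \<in> J" by (auto simp: J_def PP_def PA_def PB_def)
    from each[OF this] show "\<exists>S\<in>set xs. a \<subseteq> S \<and> S \<inter> b = {}"
      by (auto simp: w_def g_def prod_list_of_bool simp del: de_Morgan_conj split: if_splits)
  next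
    fix a assume "a \<subseteq> {..<K} \<and> card a = wa"
    then have "Inr (Inl a) \<in> J" by (auto simp: J_def PA_def)
    from each[OF this] have "length (filter (\<lambda>S. a \<subseteq> S) xs) \<le> T"
      by (intro degT) (simp add: w_def g_def prod_list_one_plus_of_bool)
    then show "real (card {S \<in> set xs. a \<subseteq> S}) \<le> 10 * K * r"
      using card_filter_set_le[of xs "\<lambda>S. a \<subseteq> S"] Tu by linarith
  next
    fix b assume "b \<subseteq> {..<K} \<and> card b = wb"
    then have "Inr (Inr b) \<in> J" by (auto simp: J_def PB_def)
    from each[OF this] have "length (filter (\<lambda>S. S \<inter> b = {}) xs) \<le> T"
      by (intro degT) (simp add: w_def g_def prod_list_one_plus_of_bool)
    then show "real (card {S \<in> set xs. S \<inter> b = {}}) \<le> 10 * K * r"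
      using card_filter_set_le[of xs "\<lambda>S. S \<inter> b = {}"] Tu by linarith
  qed simp
qed

section \<open>Choice of the size of the separating sets\<close>

lemma binomial_le_powers:
  fixes p q :: real
  assumes "p > 0" "q > 0" "1 / p + 1 / q = 1" "k \<le> n"
  shows "real (n choose k) \<le> p ^ k * q ^ (n - k)"
proof -
  \<comment> \<open>A single term of the binomial expansion of
    \<open>(1/p + 1/q) ^ n = 1\<close>.\<close>
  have "real (n choose k) * (1/p) ^ k * (1/q) ^ (n - k)
      \<le> (\<Sum>k\<le>n. real (n choose k) * (1/p) ^ k * (1/q) ^ (n - k))"
    using assms by (intro member_le_sum) auto
  also have "\<dots> = 1" using assms(3) by (simp add: binomial_ring[symmetric])
  finally show ?thesis using assms(1,2) by (simp add: power_divide field_simps)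
qed

text \<open>The middle entry is the largest of the \<open>u + 1\<close> entries of a row whose sum
  is \<open>2 ^ u\<close>.\<close>

lemma central_binomial_ge: "2 ^ u \<le> (real u + 1) * real (u choose (u div 2))"
proof -
  have "(2::nat) ^ u = (\<Sum>k\<le>u. u choose k)" by (simp add: choose_row_sum)
  also have "\<dots> \<le> (\<Sum>k\<le>u. u choose (u div 2))" by (intro sum_mono binomial_maximum)
  finally have "real (2 ^ u) \<le> real (Suc u * (u choose (u div 2)))"
    by (intro of_nat_mono) simp
  then show ?thesis by (simp add: algebra_simps)
qed

text \<open>
  With \<open>u\<close> free elements, \<open>s = wa + u div 2\<close> gives the ratio \<open>(4/3) ^ ((K + \<bar>wa - wb\<bar>) / 2)\<close> up to a
  polynomial factor.  If the cardinalities differ by more than \<open>6/11 * K\<close>, taking the smaller set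
  itself (or the complement, for the larger one) is better.  The threshold is chosen to make both
  \<open>(4/3) ^ 17\<close> and \<open>(13/8) ^ 10\<close> smaller than \<open>1.25 ^ 22\<close>.
\<close>

lemma separating_size:
  fixes M wa wb :: nat
  defines "K \<equiv> 22 * M" and "r \<equiv> 2 * (real (22 * M) + 1) * ((4/3) ^ 17) ^ M"
  assumes "wa + wb \<le> K"
  shows "\<exists>s. wa \<le> s \<and> s + wb \<le> K \<and>
    real ((K - wa) choose (s - wa)) \<le> r * real ((K - wa - wb) choose (s - wa)) \<and>
    real ((K - wb) choose s) \<le> r * real ((K - wa - wb) choose (s - wa))"
proof -
  have r0: "((4/3) ^ 17) ^ M \<le> r"
    unfolding r_def by (simp add: mult_le_cancel_right1)
  have "(1::real) \<le> ((4/3) ^ 17) ^ M" by (intro one_le_power) auto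
  with r0 have r1: "1 \<le> r" by linarith
  \<comment> \<open>\<open>5/13 + 8/13 = 1\<close>, and \<open>13/5 \<le> (13/8)^2\<close> merges
    both powers into one with exponent \<open>2 * a + u\<close>. The optimal base would be the
    golden ratio, of which \<open>13/8\<close> is a Fibonacci approximation from above.\<close>
  have big: "real ((u + a) choose a) \<le> r" if "2 * a + u \<le> 10 * M" for a u
  proof -
    have "real ((u + a) choose a) \<le> (13/5) ^ a * (13/8) ^ u"
      using binomial_le_powers[of "13/5" "13/8" a "u + a"] by simp
    also have "\<dots> \<le> ((13/8)^2) ^ a * (13/8) ^ u"
      by (intro mult_right_mono power_mono) (auto simp: power2_eq_square)
    also have "\<dots> = (13/8) ^ (2 * a + u)" by (simp only: power_add power_mult)
    also have "\<dots> \<le> (13/8) ^ (10 * M)" using that by (intro power_increasing) auto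
    also have "\<dots> = ((13/8) ^ 10) ^ M" by (rule power_mult)
    also have "\<dots> \<le> ((4/3) ^ 17) ^ M" by (intro power_mono) (auto simp: power_divide)
    finally show ?thesis using r0 by linarith
  qed
  define u where "u = K - wa - wb"
  consider "wa \<le> wb + 12 * M" "wb \<le> wa + 12 * M" | "wb > wa + 12 * M" | "wa > wb + 12 * M"
    by linarith
  then show ?thesis
  proof cases
    case 1
    define x where "x = u div 2"
    define y where "y = u - x"
    have C: "2 ^ u \<le> (real K + 1) * real (u choose x)"
    proof -
      have "(real u + 1) * real (u choose x) \<le> (real K + 1) * real (u choose x)"
        by (intro mult_right_mono) (auto simp: u_def)
      then show ?thesis using central_binomial_ge[of u] unfolding x_def by linarith
    qed
    \<comment> \<open>The weights \<open>1/4 + 3/4 = 1\<close> are chosen so that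
      \<open>4 ^ k\<close> is cancelled by the central binomial coefficient
      \<open>u choose x\<close>, about \<open>2 ^ u\<close>, leaving \<open>(4/3) ^ (n - k)\<close>.
      Here \<open>n - k\<close> is about \<open>(K + \<bar>wa - wb\<bar>) / 2\<close> at worst,
      hence at most \<open>(22 + 12) / 2 * M = 17 * M\<close>. The factor 2 in \<open>r\<close> pays
      for rounding \<open>u / 2\<close> up.\<close>
    have m: "real (n choose k) \<le> r * real (u choose x)"
      if "k \<le> n" "n - k \<le> 17 * M" "2 * k \<le> u + 1" for n k
    proof -
      have "real (n choose k) \<le> 4 ^ k * (4/3) ^ (n - k)"
        using that by (intro binomial_le_powers) auto
      also have "(4::real) ^ k = 2 ^ (2 * k)" by (simp add: power_mult)
      also have "\<dots> \<le> 2 ^ (u + 1)" using that by (intro power_increasing) auto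
      also have "(4/3::real) ^ (n - k) \<le> (4/3) ^ (17 * M)" using that by (intro power_increasing) auto
      also have "\<dots> = ((4/3) ^ 17) ^ M" by (rule power_mult)
      also have "(2::real) ^ (u + 1) * ((4/3) ^ 17) ^ M \<le> 2 * ((real K + 1) * real (u choose x)) * ((4/3) ^ 17) ^ M"
        using C by (intro mult_right_mono) auto
      also have "\<dots> = r * real (u choose x)" by (simp add: r_def K_def)
      finally show ?thesis by (simp add: mult_mono)
    qed
    have "real ((u + wb) choose x) \<le> r * real (u choose x)"
      by (rule m) (use 1 assms(3) in \<open>auto simp: x_def u_def K_def\<close>)
    moreover have "real ((u + wa) choose y) \<le> r * real (u choose x)"
      by (rule m) (use 1 assms(3) in \<open>auto simp: x_def y_def u_def K_def\<close>)
    \<comment> \<open>The estimate was made for the lower index \<open>y\<close>, since it needs an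
      index close to \<open>u / 2\<close>; symmetry returns to \<open>s = wa + x\<close>.\<close>
    moreover have "u + wa - y = wa + x" "y \<le> u + wa" by (auto simp: y_def x_def)
    then have "(u + wa) choose y = (u + wa) choose (wa + x)"
      using binomial_symmetric[of y "u + wa"] by simp
    moreover have "K - wa = u + wb" "K - wb = u + wa" using assms(3) by (auto simp: u_def)
    moreover have "wa + x + wb \<le> K" using assms(3) by (auto simp: u_def x_def)
    ultimately show ?thesis by (intro exI[of _ "wa + x"]) (simp add: u_def[symmetric])
  next
    case 2
    have "K - wb = u + wa" using assms(3) by (auto simp: u_def)
    moreover have "real ((u + wa) choose wa) \<le> r"
      using 2 assms(3) by (intro big) (auto simp: u_def K_def)
    ultimately show ?thesis using r1 assms(3) by (intro exI[of _ wa]) simp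
  next
    case 3
    have "K - wa = u + wb" using assms(3) by (auto simp: u_def)
    moreover have "real ((u + wb) choose u) \<le> r"
      using 3 assms(3) big[of wb u] binomial_symmetric[of wb "u + wb"] by (auto simp: u_def K_def)
    moreover have "K - wb - wa = u" using assms(3) by (simp add: u_def)
    ultimately show ?thesis using r1 assms(3)
      by (intro exI[of _ "K - wb"]) (simp add: u_def[symmetric])
  qed
qed

section \<open>From separating families to a fixed number of numeric keys per set\<close>

lemma finite_surj_from_segment:
  assumes "finite X" "X \<noteq> {}" "card X \<le> n"
  shows "\<exists>f. f ` {..<n::nat} = X"
proof -
  obtain h where h: "bij_betw h {..<card X} X"
    using ex_bij_betw_nat_finite[OF assms(1)] by (auto simp: atLeast0LessThan)
  \<comment> \<open>\<open>z\<close> pads the enumeration by repetition, so that all sets get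
    exactly the same number of keys and key indices form a full range.\<close>
  obtain z where z: "z \<in> X" using assms by auto
  have "(\<lambda>i. if i < card X then h i else z) ` {..<n} = X"
  proof
    show "(\<lambda>i. if i < card X then h i else z) ` {..<n} \<subseteq> X"
      using h z by (auto simp: bij_betw_def)
    have "X = (\<lambda>i. if i < card X then h i else z) ` {..<card X}"
      using h by (simp add: bij_betw_def cong: image_cong_simp)
    also have "\<dots> \<subseteq> (\<lambda>i. if i < card X then h i else z) ` {..<n}"
      using assms(3) by (intro image_mono) auto
    finally show "X \<subseteq> (\<lambda>i. if i < card X then h i else z) ` {..<n}" .
  qed
  then show ?thesis by blast
qed

text \<open>The first argument of \<open>key\<close> is the side, 1 for \<open>A\<close> and 2 for
  \<open>B\<close>, the same numbers as the input arrays. The bound \<open>m\<close> lets keys serve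
  as digits in base \<open>m\<close>.\<close>

locale disjointness_code =
  fixes K D m :: nat and key :: "nat \<Rightarrow> nat set \<Rightarrow> nat \<Rightarrow> nat"
  assumes K_pos: "0 < K" and D_pos: "0 < D" and D_le: "real D \<le> 1.25 ^ K"
    and key_less: "c \<in> {1, 2} \<Longrightarrow> v \<subseteq> {..<K} \<Longrightarrow> i < D \<Longrightarrow> key c v i < m"
    and disjoint_iff_key: "v \<subseteq> {..<K} \<Longrightarrow> w \<subseteq> {..<K} \<Longrightarrow>
      v \<inter> w = {} \<longleftrightarrow> (\<exists>i<D. \<exists>j<D. key 1 v i = key 2 w j)"

lemma exists_disjointness_code: "\<exists>K D m key. disjointness_code K D m key"
proof -
  \<comment> \<open>Integers separate the two growth rates: \<open>(4/3) ^ 17 < 134\<close> and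
    \<open>135 < 1.25 ^ 22\<close>. The leading factor \<open>22 * M + 1\<close> counts the possible
    cardinalities of the partner, and the final \<open>- 1\<close> pays for the floor in
    \<open>D\<close>.\<close>
  have "eventually (\<lambda>M. (22 * real M + 1) * (10 * (22 * real M) * (2 * (22 * real M + 1) * 134 ^ M)) \<le> 135 ^ M - 1) sequentially"
    by real_asymp
  then obtain M0 where M0: "\<And>M. M \<ge> M0 \<Longrightarrow>
      (22 * real M + 1) * (10 * (22 * real M) * (2 * (22 * real M + 1) * 134 ^ M)) \<le> 135 ^ M - 1"
    by (auto simp: eventually_sequentially)
  define M where "M = Suc M0"
  define K where "K = 22 * M"
  define r where "r = 2 * (real (22 * M) + 1) * ((4/3) ^ 17) ^ M"
  define D where "D = nat \<lfloor>(1.25::real) ^ K\<rfloor>"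
  have K2: "2 \<le> K" by (simp add: K_def M_def)
  have r1: "1 \<le> r"
  proof -
    have "1 * 1 \<le> r" unfolding r_def
      by (rule mult_mono) (auto intro!: one_le_power)
    then show ?thesis by simp
  qed
  have Du: "real D \<le> 1.25 ^ K" by (simp add: D_def)
  have "real (K + 1) * (10 * K * r) \<le> 1.25 ^ K - 1"
  proof -
    have "((4/3) ^ 17) ^ M \<le> (134 :: real) ^ M" by (intro power_mono) (auto simp: power_divide)
    then have "real (K + 1) * (10 * K * r)
        \<le> (22 * real M + 1) * (10 * (22 * real M) * (2 * (22 * real M + 1) * 134 ^ M))"
      unfolding K_def r_def by (intro mult_mono) auto
    also have "\<dots> \<le> 135 ^ M - 1" by (rule M0) (simp add: M_def)
    also have "(135 :: real) ^ M \<le> (1.25 ^ 22) ^ M" by (intro power_mono) (auto simp: power_divide)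
    also have "(1.25 ^ 22 :: real) ^ M = 1.25 ^ K" unfolding K_def by (rule power_mult[symmetric])
    finally show ?thesis by simp
  qed
  moreover have "(1.25::real) ^ K - 1 \<le> D" by (simp add: D_def)
  ultimately have Dl: "real (K + 1) * (10 * K * r) \<le> D" by linarith
  define good where "good F wa wb \<longleftrightarrow> finite F \<and>
    (\<forall>a b. a \<subseteq> {..<K} \<and> b \<subseteq> {..<K} \<and> card a = wa \<and> card b = wb \<and> a \<inter> b = {} \<longrightarrow>
       (\<exists>S\<in>F. a \<subseteq> S \<and> S \<inter> b = {})) \<and>
    (\<forall>a. a \<subseteq> {..<K} \<and> card a = wa \<longrightarrow> real (card {S\<in>F. a \<subseteq> S}) \<le> 10 * K * r) \<and>
    (\<forall>b. b \<subseteq> {..<K} \<and> card b = wb \<longrightarrow> real (card {S\<in>F. S \<inter> b = {}}) \<le> 10 * K * r)" for F wa wb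
  have "\<exists>F. good F wa wb" for wa wb
  proof (cases "wa + wb \<le> K")
    case True
    then obtain s where "wa \<le> s" "s + wb \<le> K"
      "real ((K - wa) choose (s - wa)) \<le> r * real ((K - wa - wb) choose (s - wa))"
      "real ((K - wb) choose s) \<le> r * real ((K - wa - wb) choose (s - wa))"
      using separating_size[of wa wb M] by (auto simp: K_def r_def)
    from separating_family[OF K2 this(1,2) r1 this(3,4)] show ?thesis by (simp add: good_def)
  next
    case False
    \<comment> \<open>No disjoint pair has these cardinalities, so the empty family is good.\<close>
    have "card a + card b \<le> K" if "a \<subseteq> {..<K}" "b \<subseteq> {..<K}" "a \<inter> b = {}" for a b
    proof -
      have "card (a \<union> b) = card a + card b" using that by (intro card_Un_disjoint) (auto intro: finite_subset)
      then show ?thesis using card_mono[of "{..<K}" "a \<union> b"] that by simp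
    qed
    with False have "good {} wa wb" using r1 by (auto simp: good_def)
    then show ?thesis by blast
  qed
  then obtain F where F: "\<And>wa wb. good (F wa wb) wa wb" by metis
  have sep: "\<exists>S\<in>F (card a) (card b). a \<subseteq> S \<and> S \<inter> b = {}"
    if "a \<subseteq> {..<K}" "b \<subseteq> {..<K}" "a \<inter> b = {}" for a b
    using F[of "card a" "card b", unfolded good_def, THEN conjunct2, THEN conjunct1] that by simp
  \<comment> \<open>The index \<open>w\<close> runs over the unknown cardinality of the
    partner.\<close>
  define UA where "UA a = (SIGMA w:{..K}. {S\<in>F (card a) w. a \<subseteq> S})" for a
  define UB where "UB b = (SIGMA w:{..K}. {S\<in>F w (card b). S \<inter> b = {}})" for b
  define XA where "XA a = (\<lambda>(w, S). (card a, w, S)) ` UA a" for a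
  define XB where "XB b = (\<lambda>(w, S). (w, card b, S)) ` UB b" for b
  have fin: "finite (XA a)" "finite (XB a)" for a
    using F by (auto simp: XA_def XB_def UA_def UB_def good_def)
  have cA: "card (XA a) \<le> D" if "a \<subseteq> {..<K}" for a
  proof -
    have "card (XA a) \<le> card (UA a)" unfolding XA_def
      using F by (intro card_image_le) (auto simp: UA_def good_def)
    also have "\<dots> = (\<Sum>w\<le>K. card {S\<in>F (card a) w. a \<subseteq> S})" unfolding UA_def
      using F by (intro card_SigmaI) (auto simp: good_def)
    finally have "real (card (XA a)) \<le> (\<Sum>w\<le>K. real (card {S\<in>F (card a) w. a \<subseteq> S}))"
      unfolding of_nat_sum[symmetric] by (rule of_nat_mono)
    also have "\<dots> \<le> real (card {..K}) * (10 * K * r)"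
      using F that by (intro sum_bounded_above) (auto simp: good_def)
    finally show ?thesis using Dl by simp
  qed
  have cB: "card (XB a) \<le> D" if "a \<subseteq> {..<K}" for a
  proof -
    have "card (XB a) \<le> card (UB a)" unfolding XB_def
      using F by (intro card_image_le) (auto simp: UB_def good_def)
    also have "\<dots> = (\<Sum>w\<le>K. card {S\<in>F w (card a). S \<inter> a = {}})" unfolding UB_def
      using F by (intro card_SigmaI) (auto simp: good_def)
    finally have "real (card (XB a)) \<le> (\<Sum>w\<le>K. real (card {S\<in>F w (card a). S \<inter> a = {}}))"
      unfolding of_nat_sum[symmetric] by (rule of_nat_mono)
    also have "\<dots> \<le> real (card {..K}) * (10 * K * r)"
      using F that by (intro sum_bounded_above) (auto simp: good_def)
    finally show ?thesis using Dl by simp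
  qed
  have iff: "XA a \<inter> XB b \<noteq> {} \<longleftrightarrow> a \<inter> b = {}" if "a \<subseteq> {..<K}" "b \<subseteq> {..<K}" for a b
  proof
    assume "XA a \<inter> XB b \<noteq> {}"
    then show "a \<inter> b = {}" by (auto simp: XA_def XB_def UA_def UB_def)
  next
    assume "a \<inter> b = {}"
    with sep[OF that] obtain S where S: "S \<in> F (card a) (card b)" "a \<subseteq> S" "S \<inter> b = {}"
      by auto
    have "card a \<le> K" "card b \<le> K" using that card_mono[of "{..<K}"] by fastforce+
    with S have "(card a, card b, S) \<in> XA a \<inter> XB b"
      by (auto simp: XA_def XB_def UA_def UB_def image_iff)
    then show "XA a \<inter> XB b \<noteq> {}" by blast
  qed
  have nA: "XA a \<noteq> {}" if "a \<subseteq> {..<K}" for a using iff[of a "{}"] that by auto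
  have nB: "XB a \<noteq> {}" if "a \<subseteq> {..<K}" for a using iff[of "{}" a] that by auto
  have "\<forall>a. \<exists>f. a \<subseteq> {..<K} \<longrightarrow> f ` {..<D} = XA a"
    using finite_surj_from_segment[OF fin(1) nA cA] by blast
  then obtain fA where fA: "\<And>a. a \<subseteq> {..<K} \<Longrightarrow> fA a ` {..<D} = XA a" by metis
  have "\<forall>a. \<exists>f. a \<subseteq> {..<K} \<longrightarrow> f ` {..<D} = XB a"
    using finite_surj_from_segment[OF fin(2) nB cB] by blast
  then obtain fB where fB: "\<And>a. a \<subseteq> {..<K} \<Longrightarrow> fB a ` {..<D} = XB a" by metis
  define Z where "Z = (\<Union>a\<in>Pow {..<K}. XA a \<union> XB a)"
  have fZ: "finite Z" unfolding Z_def using fin by auto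
  obtain \<phi> :: "nat \<times> nat \<times> nat set \<Rightarrow> nat" and m where \<phi>: "\<phi> ` Z = {i. i < m}" "inj_on \<phi> Z"
    using finite_imp_inj_to_nat_seg[OF fZ] by auto
  have inZ: "fA a i \<in> Z" "fB a i \<in> Z" if "a \<subseteq> {..<K}" "i < D" for a i
    using fA[OF that(1)] fB[OF that(1)] that unfolding Z_def by blast+
  have "0 < card (XA {})" using nA[of "{}"] fin(1)[of "{}"] by (simp add: card_gt_0_iff)
  then have D0: "0 < D" using cA[of "{}"] by simp
  have "a \<inter> b = {} \<longleftrightarrow> (\<exists>i<D. \<exists>j<D. \<phi> (fA a i) = \<phi> (fB b j))" if ab: "a \<subseteq> {..<K}" "b \<subseteq> {..<K}" for a b
  proof -
    have "a \<inter> b = {} \<longleftrightarrow> fA a ` {..<D} \<inter> fB b ` {..<D} \<noteq> {}" using iff[OF ab] fA[OF ab(1)] fB[OF ab(2)] by simp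
    also have "\<dots> \<longleftrightarrow> (\<exists>i<D. \<exists>j<D. fA a i = fB b j)" by blast
    also have "\<dots> \<longleftrightarrow> (\<exists>i<D. \<exists>j<D. \<phi> (fA a i) = \<phi> (fB b j))"
      using \<phi>(2) inZ ab by (metis inj_onD)
    finally show ?thesis .
  qed
  moreover have "\<phi> (fA v i) < m \<and> \<phi> (fB v i) < m" if "i < D" "v \<subseteq> {..<K}" for v i
    using inZ[OF that(2,1)] \<phi>(1) by blast
  ultimately have "disjointness_code K D m (\<lambda>c v i. \<phi> (if c = 1 then fA v i else fB v i))"
    using Du D0 K2 by unfold_locales auto
  then show ?thesis by blast
qed

section \<open>Time-bounded Hoare rules\<close>

text \<open>Exponent for the size of values: over cells bounded by \<open>V\<close> an expression
  evaluates to at most \<open>V ^ exp_nodes e\<close>, as each operation at most multiplies the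
  bounds of its operands.\<close>

fun exp_nodes :: "exp \<Rightarrow> nat" where
  "exp_nodes (Const k) = 1"
| "exp_nodes (Load x e) = exp_nodes e + 1"
| "exp_nodes (Bin f e1 e2) = exp_nodes e1 + exp_nodes e2 + 1"

text \<open>Cost in units of \<open>size_of_nat V\<close>. A loaded cell costs one unit, whereas an
  intermediate result may be as long as \<open>exp_nodes\<close> units.\<close>

fun exp_weight :: "exp \<Rightarrow> nat" where
  "exp_weight (Const k) = 1"
| "exp_weight (Load x e) = exp_weight e + 1"
| "exp_weight (Bin f e1 e2) = exp_weight e1 + exp_weight e2 + exp_nodes (Bin f e1 e2)"

fun exp_bound :: "exp \<Rightarrow> nat" where
  "exp_bound (Const k) = k"
| "exp_bound (Load x e) = exp_bound e"
| "exp_bound (Bin f e1 e2) = max (exp_bound e1) (exp_bound e2)"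

fun prog_weight :: "prog \<Rightarrow> nat" where
  "prog_weight Skip = 1"
| "prog_weight (Assign x i e) = exp_weight i + exp_weight e"
| "prog_weight (Flip x i) = exp_weight i + 1"
| "prog_weight (Seq P Q) = prog_weight P + prog_weight Q"
| "prog_weight (If e P Q) = exp_weight e + prog_weight P + prog_weight Q"
| "prog_weight (While e P) = exp_weight e + prog_weight P"

fun prog_bound :: "prog \<Rightarrow> nat" where
  "prog_bound Skip = 0"
| "prog_bound (Assign x i e) = max (exp_bound i) (exp_bound e)"
| "prog_bound (Flip x i) = exp_bound i"
| "prog_bound (Seq P Q) = max (prog_bound P) (prog_bound Q)"
| "prog_bound (If e P Q) = max (exp_bound e) (max (prog_bound P) (prog_bound Q))"
| "prog_bound (While e P) = max (exp_bound e) (prog_bound P)"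

lemma size_of_nat_mono: "x \<le> y \<Longrightarrow> size_of_nat x \<le> size_of_nat y"
  unfolding size_of_nat_def using floorlog_mono by simp

lemma size_of_nat_power: "1 \<le> k \<Longrightarrow> size_of_nat (V ^ k) \<le> k * size_of_nat V"
proof -
  assume k: "1 \<le> k"
  have "V < 2 ^ floorlog 2 V" by (rule floorlog_leD) auto
  then have "V ^ k < (2 ^ floorlog 2 V) ^ k" using k by (intro power_strict_mono) auto
  then have "V ^ k < 2 ^ (k * floorlog 2 V)" by (simp add: power_mult[symmetric] mult.commute)
  then have "floorlog 2 (V ^ k) \<le> k * floorlog 2 V" by (intro floorlog_leI) auto
  then show ?thesis unfolding size_of_nat_def using k by (simp add: algebra_simps)
qed

lemma exp_nodes_pos: "1 \<le> exp_nodes e"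
  by (cases e) auto

lemma exp_val_le:
  assumes "\<And>x i. s x i \<le> V" "2 \<le> V" "exp_bound e \<le> V"
  shows "exp_val e s \<le> V ^ exp_nodes e"
  using assms(3)
proof (induction e)
  case (Load x e)
  have "V ^ 1 \<le> V ^ exp_nodes (Load x e)" using assms(2) by (intro power_increasing) auto
  with assms(1)[of x "exp_val e s"] show ?case by (simp del: exp_nodes.simps)
next
  case (Bin f e1 e2)
  define a where "a = V ^ exp_nodes e1"
  define b where "b = V ^ exp_nodes e2"
  have ab: "exp_val e1 s \<le> a" "exp_val e2 s \<le> b" using Bin by (auto simp: a_def b_def)
  have V_le: "V \<le> V ^ exp_nodes e" for e
    using power_increasing[of 1 "exp_nodes e" V] exp_nodes_pos[of e] assms(2) by simp
  have a2: "2 \<le> a" "2 \<le> b"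
    using assms(2) V_le[of e1] V_le[of e2] by (simp_all add: a_def b_def)
  \<comment> \<open>Holds because both bounds are at least 2; thus the product bound covers addition
    as well.\<close>
  have "a + b \<le> a * b"
  proof -
    obtain a' b' where "a = 2 + a'" "b = 2 + b'" using a2 by (metis le_Suc_ex)
    then show ?thesis by simp
  qed
  moreover have "a * 1 \<le> a * b" using a2 by (intro mult_le_mono2) simp
  then have "exp_val e1 s \<le> a * b" using ab(1) by linarith
  moreover have "exp_val e1 s * exp_val e2 s \<le> a * b" using ab by (rule mult_le_mono)
  moreover have "exp_val e1 s div exp_val e2 s \<le> a * b"
    using div_le_dividend \<open>exp_val e1 s \<le> a * b\<close> by (rule order_trans)
  ultimately have "binop_val f (exp_val e1 s) (exp_val e2 s) \<le> a * b"
    using ab by (cases f) (simp_all add: le_diff_conv order_trans)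
  also have "a * b \<le> V ^ exp_nodes (Bin f e1 e2)"
    using assms(2) by (simp add: a_def b_def power_add)
  finally show ?case by simp
qed simp

lemma exp_cost_le:
  assumes "\<And>x i. s x i \<le> V" "2 \<le> V" "exp_bound e \<le> V"
  shows "exp_cost e s \<le> exp_weight e * size_of_nat V"
  using assms(3)
proof (induction e)
  case (Const k)
  then show ?case by (simp add: size_of_nat_mono)
next
  case (Load x e)
  then show ?case using size_of_nat_mono[OF assms(1)[of x "exp_val e s"]] by simp
next
  case (Bin f e1 e2)
  have "size_of_nat (exp_val (Bin f e1 e2) s) \<le> size_of_nat (V ^ exp_nodes (Bin f e1 e2))"
    using exp_val_le[OF assms(1,2) Bin.prems] by (rule size_of_nat_mono)
  also have "\<dots> \<le> exp_nodes (Bin f e1 e2) * size_of_nat V"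
    by (intro size_of_nat_power) simp
  finally show ?case using Bin by (simp add: add_mult_distrib)
qed

text \<open>
  \<open>V\<close> bounds all memory cells throughout the run.  The time bound is split into the static factor
  \<open>prog_weight P\<close> and the dynamic factor \<open>X\<close>, which counts loop iterations times \<open>size_of_nat V\<close>.
\<close>

definition runs :: "nat \<Rightarrow> nat \<Rightarrow> (store \<Rightarrow> bool) \<Rightarrow> prog \<Rightarrow> (store \<Rightarrow> bool) \<Rightarrow> bool" where
  "runs V X Pre P Post \<longleftrightarrow> 2 \<le> V \<longrightarrow> prog_bound P \<le> V \<longrightarrow>
    (\<forall>s \<omega> p. (\<forall>x i. s x i \<le> V) \<longrightarrow> Pre s \<longrightarrow>
      (\<exists>t s'. exec \<omega> P (s, p) t (s', p) \<and> t \<le> prog_weight P * X \<and> (\<forall>x i. s' x i \<le> V) \<and> Post s'))"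

lemma runsD:
  assumes "runs V X Pre P Post" "2 \<le> V" "prog_bound P \<le> V" "\<forall>x i. s x i \<le> V" "Pre s"
  shows "\<exists>t s'. exec \<omega> P (s, p) t (s', p) \<and> t \<le> prog_weight P * X \<and>
    (\<forall>x i. s' x i \<le> V) \<and> Post s'"
  using assms unfolding runs_def by simp

lemma size_of_nat_pos: "1 \<le> size_of_nat V"
  by (simp add: size_of_nat_def)

lemma runs_Skip:
  assumes "\<And>s. Pre s \<Longrightarrow> Post s" "size_of_nat V \<le> X"
  shows "runs V X Pre Skip Post"
  unfolding runs_def
proof (intro impI allI)
  fix s p and \<omega> :: "nat \<Rightarrow> bool"
  assume "\<forall>x i. s x i \<le> V" "Pre s"
  then show "\<exists>t s'. exec \<omega> Skip (s, p) t (s', p) \<and> t \<le> prog_weight Skip * X \<and> (\<forall>x i. s' x i \<le> V) \<and> Post s'"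
    using exec_Skip assms size_of_nat_pos[of V] by (intro exI[of _ 1] exI[of _ s]) auto
qed

lemma runs_Assign:
  assumes "\<And>s. Pre s \<Longrightarrow> \<forall>x i. s x i \<le> V \<Longrightarrow>
      exp_val e s \<le> V \<and> Post (store_upd s x (exp_val i s) (exp_val e s))"
    and "size_of_nat V \<le> X"
  shows "runs V X Pre (Assign x i e) Post"
  unfolding runs_def
proof (intro impI allI)
  fix s p and \<omega> :: "nat \<Rightarrow> bool"
  assume V: "2 \<le> V" "prog_bound (Assign x i e) \<le> V" and s: "\<forall>x i. s x i \<le> V" "Pre s"
  have "exp_cost i s + exp_cost e s \<le> exp_weight i * size_of_nat V + exp_weight e * size_of_nat V"
    using V s by (intro add_mono exp_cost_le) auto
  also have "\<dots> \<le> prog_weight (Assign x i e) * X"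
    using assms(2) by (simp add: add_mult_distrib[symmetric])
  finally show "\<exists>t s'. exec \<omega> (Assign x i e) (s, p) t (s', p) \<and> t \<le> prog_weight (Assign x i e) * X
      \<and> (\<forall>x i. s' x i \<le> V) \<and> Post s'"
    using exec_Assign[of \<omega> x i e s p] assms(1)[OF s(2,1)] s(1)
    by (intro exI[of _ "exp_cost i s + exp_cost e s"]
        exI[of _ "store_upd s x (exp_val i s) (exp_val e s)"]) (simp add: store_upd_def)
qed

lemma runs_Seq:
  assumes "runs V X Pre P R" "runs V X R Q Post"
  shows "runs V X Pre (Seq P Q) Post"
  unfolding runs_def
proof (intro impI allI)
  fix s p and \<omega> :: "nat \<Rightarrow> bool"
  assume V: "2 \<le> V" "prog_bound (Seq P Q) \<le> V" and s: "\<forall>x i. s x i \<le> V" "Pre s"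
  obtain t1 s1 where 1: "exec \<omega> P (s, p) t1 (s1, p)" "t1 \<le> prog_weight P * X"
    "\<forall>x i. s1 x i \<le> V" "R s1"
    using runsD[OF assms(1), of s \<omega> p] V s by auto
  obtain t2 s2 where 2: "exec \<omega> Q (s1, p) t2 (s2, p)" "t2 \<le> prog_weight Q * X"
    "\<forall>x i. s2 x i \<le> V" "Post s2"
    using runsD[OF assms(2), of s1 \<omega> p] V 1 by auto
  show "\<exists>t s'. exec \<omega> (Seq P Q) (s, p) t (s', p) \<and> t \<le> prog_weight (Seq P Q) * X
      \<and> (\<forall>x i. s' x i \<le> V) \<and> Post s'"
    using exec_Seq[OF 1(1) 2(1)] 1 2
    by (intro exI[of _ "t1 + t2"] exI[of _ s2]) (simp add: add_mult_distrib)
qed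

lemma runs_If:
  assumes "runs V X (\<lambda>s. Pre s \<and> exp_val e s \<noteq> 0) P Post"
    and "runs V X (\<lambda>s. Pre s \<and> exp_val e s = 0) Q Post"
    and "size_of_nat V \<le> X"
  shows "runs V X Pre (If e P Q) Post"
  unfolding runs_def
proof (intro impI allI)
  fix s p and \<omega> :: "nat \<Rightarrow> bool"
  assume V: "2 \<le> V" "prog_bound (If e P Q) \<le> V" and s: "\<forall>x i. s x i \<le> V" "Pre s"
  have "exp_cost e s \<le> exp_weight e * size_of_nat V" using V s by (intro exp_cost_le) auto
  also have "\<dots> \<le> exp_weight e * X" using assms(3) by simp
  finally have c: "exp_cost e s \<le> exp_weight e * X" .
  show "\<exists>t s'. exec \<omega> (If e P Q) (s, p) t (s', p) \<and> t \<le> prog_weight (If e P Q) * X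
      \<and> (\<forall>x i. s' x i \<le> V) \<and> Post s'"
  proof (cases "exp_val e s = 0")
    case True
    obtain t s' where *: "exec \<omega> Q (s, p) t (s', p)" "t \<le> prog_weight Q * X"
      "\<forall>x i. s' x i \<le> V" "Post s'"
      using runsD[OF assms(2), of s \<omega> p] V s True by auto
    then have "exp_cost e s + t \<le> prog_weight (If e P Q) * X" using c by (simp add: add_mult_distrib)
    with * exec_If_False[OF True *(1)] show ?thesis by blast
  next
    case False
    obtain t s' where *: "exec \<omega> P (s, p) t (s', p)" "t \<le> prog_weight P * X"
      "\<forall>x i. s' x i \<le> V" "Post s'"
      using runsD[OF assms(1), of s \<omega> p] V s False by auto
    then have "exp_cost e s + t \<le> prog_weight (If e P Q) * X" using c by (simp add: add_mult_distrib)
    with * exec_If_True[OF False *(1)] show ?thesis by blast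
  qed
qed

lemma runs_While:
  assumes step: "\<And>k. k < N \<Longrightarrow> runs V X (I k) P (I (Suc k))"
    and guard: "\<And>k s. I k s \<Longrightarrow> k \<le> N \<Longrightarrow> exp_val e s \<noteq> 0 \<longleftrightarrow> k < N"
    and X: "size_of_nat V \<le> X"
  shows "runs V ((N + 1) * X) (I 0) (While e P) (I N)"
  unfolding runs_def
proof (intro impI allI)
  fix s p and \<omega> :: "nat \<Rightarrow> bool"
  assume V: "2 \<le> V" "prog_bound (While e P) \<le> V" and s: "\<forall>x i. s x i \<le> V" "I 0 s"
  have cost: "exp_cost e s \<le> exp_weight e * X" if "\<forall>x i. s x i \<le> V" for s
  proof -
    have "exp_cost e s \<le> exp_weight e * size_of_nat V" using V that by (intro exp_cost_le) auto
    also have "\<dots> \<le> exp_weight e * X" using X by simp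
    finally show ?thesis .
  qed
  \<comment> \<open>Induction on the number \<open>k\<close> of iterations still to come; the guard
    is evaluated \<open>k + 1\<close> times.\<close>
  have "\<exists>t s'. exec \<omega> (While e P) (s, p) t (s', p) \<and> t \<le> (k + 1) * (prog_weight (While e P) * X)
      \<and> (\<forall>x i. s' x i \<le> V) \<and> I N s'"
    if "k \<le> N" "\<forall>x i. s x i \<le> V" "I (N - k) s" for k s
    using that
  proof (induction k arbitrary: s)
    case 0
    then have "exp_val e s = 0" using guard[of N s] by simp
    from exec_While_False[OF this] show ?case using cost[OF 0(2)] 0
      by (intro exI[of _ "exp_cost e s"] exI[of _ s]) (simp add: add_mult_distrib)
  next
    case (Suc k)
    have ne: "exp_val e s \<noteq> 0" using guard[of "N - Suc k" s] Suc by simp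
    have r: "runs V X (I (N - Suc k)) P (I (N - k))" using step[of "N - Suc k"] Suc.prems(1)
      by (simp add: Suc_diff_Suc)
    obtain t1 s1 where 1: "exec \<omega> P (s, p) t1 (s1, p)" "t1 \<le> prog_weight P * X"
      "\<forall>x i. s1 x i \<le> V" "I (N - k) s1"
      using runsD[OF r, of s \<omega> p] V Suc.prems(2,3) by auto
    obtain t2 s2 where 2: "exec \<omega> (While e P) (s1, p) t2 (s2, p)"
      "t2 \<le> (k + 1) * (prog_weight (While e P) * X)" "\<forall>x i. s2 x i \<le> V" "I N s2"
      using Suc.IH[OF Suc_leD[OF Suc.prems(1)] 1(3,4)] by blast
    have "exp_cost e s + t1 + t2 \<le> (Suc k + 1) * (prog_weight (While e P) * X)"
      using cost[OF Suc.prems(2)] 1(2) 2(2) by (simp add: add_mult_distrib)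
    with exec_While_True[OF ne 1(1) 2(1)] 2(3,4) show ?case by blast
  qed
  from this[of N s] s show "\<exists>t s'. exec \<omega> (While e P) (s, p) t (s', p)
      \<and> t \<le> prog_weight (While e P) * ((N + 1) * X) \<and> (\<forall>x i. s' x i \<le> V) \<and> I N s'"
    by (simp add: algebra_simps)
qed

lemma runs_mono:
  assumes "runs V X Pre P Post" "X \<le> X'" "\<And>s. Pre' s \<Longrightarrow> Pre s" "\<And>s. Post s \<Longrightarrow> Post' s"
  shows "runs V X' Pre' P Post'"
  using assms mult_le_mono2[OF assms(2), of "prog_weight P"] unfolding runs_def
  by (meson order_trans)

text \<open>Base \<open>D\<close> expansion: one counter below \<open>D ^ t\<close> runs through all
  choices of a key index for each of \<open>t\<close> blocks.\<close>

lemma exists_digits: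
  assumes "\<forall>j<t. f j < (D::nat)"
  shows "\<exists>e<D ^ t. \<forall>j<t. e div D ^ j mod D = f j"
  using assms
proof (induction t)
  case (Suc t)
  then obtain e where e: "e < D ^ t" "\<forall>j<t. e div D ^ j mod D = f j" by auto
  have ft: "f t < D" using Suc.prems by simp
  then have D: "0 < D" by simp
  have "(f t * D ^ t + e) div D ^ j mod D = f j" if "j < Suc t" for j
  proof (cases "j = t")
    case True
    then show ?thesis using e ft D by simp
  next
    case False
    then obtain q where q: "t = Suc q + j"
      using \<open>j < Suc t\<close> less_iff_Suc_add[of j t] by auto
    have "f t * D ^ t + e = e + D ^ j * (f t * D ^ Suc q)" using q by (simp add: power_add)
    then have "(f t * D ^ t + e) div D ^ j = (e + D ^ j * (f t * D ^ Suc q)) div D ^ j"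
      by (simp only:)
    also have "\<dots> = f t * D ^ Suc q + e div D ^ j" using D by (intro div_mult_self2) simp
    also have "\<dots> = e div D ^ j + f t * D ^ q * D" by simp
    finally have "(f t * D ^ t + e) div D ^ j mod D = (e div D ^ j) mod D" by (simp only: mod_mult_self1)
    then show ?thesis using e(2) False that by simp
  qed
  moreover have "f t * D ^ t + e < D ^ Suc t"
  proof -
    have "f t * D ^ t + e < (f t + 1) * D ^ t" using e(1) by simp
    also have "\<dots> \<le> D * D ^ t" using ft by (intro mult_le_mono1) simp
    finally show ?thesis by simp
  qed
  ultimately show ?case by blast
qed simp

lemma set_encode_less: "v \<subseteq> {..<K} \<Longrightarrow> set_encode v < 2 ^ K"
proof -
  assume "v \<subseteq> {..<K}"
  then have "set_encode v \<le> (\<Sum>i<K. 2 ^ i)" unfolding set_encode_def by (intro sum_mono2) auto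
  also have "\<dots> < (2::nat) ^ K" by (induction K) auto
  finally show ?thesis .
qed

section \<open>The program\<close>

text \<open>
  Scalar variables are cells of array 0: besides the input \<open>n\<close> and \<open>d\<close> in cells 0 and 1, cell 2 holds the
  number of keys per member, 3 the current member, 4 the index of its current key, 5 the current
  block, 6 the key digits not yet consumed, and 7 the key.  Array 4 is the table of keys, with
  entry \<open>i + 1\<close> for position \<open>i\<close>.
\<close>

abbreviation scalar :: "nat \<Rightarrow> exp" where "scalar k \<equiv> Load 0 (Const k)"
abbreviation put :: "nat \<Rightarrow> exp \<Rightarrow> prog" where "put k e \<equiv> Assign 0 (Const k) e"

text \<open>Truncated subtraction makes these two expressions 0 or 1.\<close>

definition indicator_exp :: "exp \<Rightarrow> exp" where
  "indicator_exp e = Bin Minus (Const 1) (Bin Minus (Const 1) e)"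

definition equal_exp :: "exp \<Rightarrow> exp \<Rightarrow> exp" where
  "equal_exp e f = Bin Minus (Const 1) (Bin Plus (Bin Minus e f) (Bin Minus f e))"

text \<open>A constant table written as the sum of \<open>g w * [e = w]\<close> over all
  \<open>w\<close> in range. Its length depends on the table only, so it costs a constant
  factor.\<close>

fun table_exp :: "(nat \<Rightarrow> nat) \<Rightarrow> nat \<Rightarrow> exp \<Rightarrow> exp" where
  "table_exp g 0 e = Const 0"
| "table_exp g (Suc w) e = Bin Plus (table_exp g w e) (Bin Times (Const (g w)) (equal_exp e (Const w)))"

lemma exp_val_table_exp:
  "exp_val (table_exp g N e) s = (if exp_val e s < N then g (exp_val e s) else 0)"
  by (induction N) (auto simp: equal_exp_def less_Suc_eq)

section \<open>Keys of whole sets and the program that computes them\<close>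

context disjointness_code
begin

definition block :: "nat \<Rightarrow> nat set \<Rightarrow> nat \<Rightarrow> nat set" where
  "block d a j = {l. l < K \<and> j * K + l < d \<and> Suc (j * K + l) \<in> a}"

text \<open>The base \<open>D\<close> digits of \<open>e\<close> select one key per block, and the
  selected keys become the digits of a number in base \<open>m\<close>.\<close>

fun hkey :: "nat \<Rightarrow> nat \<Rightarrow> nat set \<Rightarrow> nat \<Rightarrow> nat \<Rightarrow> nat" where
  "hkey c d a e 0 = 0"
| "hkey c d a e (Suc j) = hkey c d a e j * m + key c (block d a j) (e div D ^ j mod D)"

lemma block_subset: "block d a j \<subseteq> {..<K}"
  by (auto simp: block_def)

lemma key_block_less: "c \<in> {1, 2} \<Longrightarrow> key c (block d a j) (e mod D) < m"
  using key_less block_subset D_pos by simp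

lemma m_pos: "0 < m"
  using key_less[of 1 "{}" 0] D_pos by simp

lemma hkey_less: "c \<in> {1, 2} \<Longrightarrow> hkey c d a e j < m ^ j"
proof (induction j)
  case (Suc j)
  have "hkey c d a e (Suc j) < hkey c d a e j * m + m"
    using key_block_less[OF Suc.prems] by simp
  also have "\<dots> = Suc (hkey c d a e j) * m" by simp
  also have "\<dots> \<le> m ^ j * m" using Suc by (intro mult_le_mono1) simp
  finally show ?case by (simp add: mult.commute)
qed simp

text \<open>Digits below \<open>m\<close> are recovered by \<open>div\<close> and
  \<open>mod\<close>, so equality of packed keys is equality block by block.\<close>

lemma hkey_eq_iff:
  "hkey 1 d a e t = hkey 2 d b f t \<longleftrightarrow>
   (\<forall>j<t. key 1 (block d a j) (e div D ^ j mod D) = key 2 (block d b j) (f div D ^ j mod D))"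
proof (induction t)
  case (Suc t)
  have "x * m + y = x' * m + y' \<longleftrightarrow> x = x' \<and> y = y'" if "y < m" "y' < m" for x y x' y'
  proof
    assume eq: "x * m + y = x' * m + y'"
    from arg_cong[OF eq, of "\<lambda>z. z div m"] arg_cong[OF eq, of "\<lambda>z. z mod m"] that
    show "x = x' \<and> y = y'" by simp
  qed simp
  from this[OF key_block_less key_block_less] Suc show ?case
    by (auto simp: less_Suc_eq)
qed simp

lemma disjoint_iff_block:
  assumes "a \<subseteq> {1..d}" "d \<le> t * K"
  shows "a \<inter> b = {} \<longleftrightarrow> (\<forall>j<t. block d a j \<inter> block d b j = {})"
proof
  assume *: "\<forall>j<t. block d a j \<inter> block d b j = {}"
  show "a \<inter> b = {}"
  proof (rule ccontr)
    assume "a \<inter> b \<noteq> {}"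
    then obtain z where z: "z \<in> a" "z \<in> b" by blast
    with assms(1) have "1 \<le> z" "z \<le> d" by auto
    then obtain y where "z = Suc y" "y < d" by (cases z) auto
    with z have y: "Suc y \<in> a" "Suc y \<in> b" "y < d" by auto
    then have "y mod K \<in> block d a (y div K) \<inter> block d b (y div K)"
      using K_pos by (simp add: block_def)
    moreover have "y div K < t" using y(3) assms(2) K_pos
      by (simp add: div_less_iff_less_mult)
    ultimately show False using * by blast
  qed
qed (auto simp: block_def)

lemma disjoint_iff_hkey:
  assumes "a \<subseteq> {1..d}" "d \<le> t * K"
  shows "a \<inter> b = {} \<longleftrightarrow> (\<exists>e<D ^ t. \<exists>f<D ^ t. hkey 1 d a e t = hkey 2 d b f t)"
proof
  assume disj: "a \<inter> b = {}"
  have "\<exists>x<D. \<exists>y<D. key 1 (block d a j) x = key 2 (block d b j) y" if "j < t" for j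
  proof -
    have "block d a j \<inter> block d b j = {}" using disjoint_iff_block[OF assms, of b] disj that by simp
    then show ?thesis using disjoint_iff_key[OF block_subset block_subset, of d a j d b j] by simp
  qed
  then obtain x y where xy:
    "\<And>j. j < t \<Longrightarrow> x j < D \<and> y j < D \<and> key 1 (block d a j) (x j) = key 2 (block d b j) (y j)"
    by metis
  obtain e where e: "e < D ^ t" "\<forall>j<t. e div D ^ j mod D = x j"
    using exists_digits[of t x D] xy by blast
  obtain f where f: "f < D ^ t" "\<forall>j<t. f div D ^ j mod D = y j"
    using exists_digits[of t y D] xy by blast
  have "hkey 1 d a e t = hkey 2 d b f t" unfolding hkey_eq_iff using e f xy by simp
  with e f show "\<exists>e<D ^ t. \<exists>f<D ^ t. hkey 1 d a e t = hkey 2 d b f t" by blast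
next
  assume "\<exists>e<D ^ t. \<exists>f<D ^ t. hkey 1 d a e t = hkey 2 d b f t"
  then obtain e f where ef: "hkey 1 d a e t = hkey 2 d b f t" by blast
  have *: "key 1 (block d a j) (e div D ^ j mod D) = key 2 (block d b j) (f div D ^ j mod D)" if "j < t" for j
    using ef that unfolding hkey_eq_iff by blast
  have "block d a j \<inter> block d b j = {}" if "j < t" for j
    using *[OF that] disjoint_iff_key[OF block_subset block_subset, of d a j d b j] D_pos
    by simp (meson mod_less_divisor)
  then show "a \<inter> b = {}" using disjoint_iff_block[OF assms] by blast
qed

definition blocks_exp :: exp where
  "blocks_exp = Bin Divide (Bin Plus (scalar 1) (Const (K - 1))) (Const K)"

text \<open>The last block may stick out beyond \<open>d\<close>. There the array access would read
  the row of the next member, and the indicator factor replaces the result by 0.\<close>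

definition bit_exp :: "nat \<Rightarrow> nat \<Rightarrow> exp" where
  "bit_exp c l = (let pos = Bin Plus (Bin Times (scalar 5) (Const K)) (Const l) in
     Bin Times (Load c (Bin Plus (Bin Times (scalar 3) (scalar 1)) pos))
       (indicator_exp (Bin Minus (scalar 1) pos)))"

fun block_exp :: "nat \<Rightarrow> nat \<Rightarrow> exp" where
  "block_exp c 0 = Const 0"
| "block_exp c (Suc l) = Bin Plus (block_exp c l) (Bin Times (Const (2 ^ l)) (bit_exp c l))"

definition digit_exp :: exp where
  "digit_exp = Bin Minus (scalar 6) (Bin Times (Bin Divide (scalar 6) (Const D)) (Const D))"

text \<open>The table is indexed by the pair of block and digit, packed as
  \<open>set_encode v * D + x\<close>; this is below \<open>2 ^ K * D\<close>.\<close>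

definition key_exp :: "nat \<Rightarrow> exp" where
  "key_exp c = Bin Plus (Bin Times (scalar 7) (Const m))
     (table_exp (\<lambda>w. key c (set_decode (w div D)) (w mod D)) (2 ^ K * D)
       (Bin Plus (Bin Times (block_exp c K) (Const D)) digit_exp))"

definition key_prog :: "nat \<Rightarrow> prog" where
  "key_prog c = Seq (put 7 (Const 0)) (Seq (put 6 (scalar 4)) (Seq (put 5 (Const 0))
     (While (Bin Minus blocks_exp (scalar 5))
       (Seq (put 7 (key_exp c))
       (Seq (put 6 (Bin Divide (scalar 6) (Const D)))
         (put 5 (Bin Plus (scalar 5) (Const 1))))))))"

definition power_prog :: prog where
  "power_prog = Seq (put 2 (Const 1)) (Seq (put 5 (Const 0))
     (While (Bin Minus blocks_exp (scalar 5))
       (Seq (put 2 (Bin Times (scalar 2) (Const D)))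
         (put 5 (Bin Plus (scalar 5) (Const 1))))))"

definition scan :: "nat \<Rightarrow> prog \<Rightarrow> prog" where
  "scan c act = Seq (put 3 (Const 0))
     (While (Bin Minus (scalar 0) (scalar 3))
       (Seq (Seq (put 4 (Const 0))
         (While (Bin Minus (scalar 2) (scalar 4))
           (Seq (key_prog c) (Seq act (put 4 (Bin Plus (scalar 4) (Const 1)))))))
       (put 3 (Bin Plus (scalar 3) (Const 1)))))"

definition store_prog :: prog where
  "store_prog = Assign 4 (scalar 7) (Bin Plus (scalar 3) (Const 1))"

definition lookup_prog :: prog where
  "lookup_prog = If (Load 4 (scalar 7))
     (Seq (Assign 3 (Const 1) (Bin Minus (Load 4 (scalar 7)) (Const 1)))
     (Seq (Assign 3 (Const 2) (scalar 3))
       (Assign 3 (Const 0) (Const 1)))) Skip"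

definition ov_prog :: prog where
  "ov_prog = Seq power_prog (Seq (scan 1 store_prog) (scan 2 lookup_prog))"

end

section \<open>Correctness and cost on one instance, with \<open>t\<close> blocks and memory bound
  \<open>V\<close>\<close>

locale ov_run = disjointness_code +
  fixes n d :: nat and A B :: "nat set list" and V L t :: nat
  assumes inst: "OV_instance n d A B"
    and V: "2 \<le> V" "n \<le> V" "d \<le> V" "D ^ t \<le> V" "m ^ t \<le> V"
    and L: "L = size_of_nat V" and t: "t = (d + (K - 1)) div K"
begin

definition family :: "nat \<Rightarrow> nat set list" where
  "family c = (if c = 1 then A else B)"

text \<open>The shared frame of all loops; it leaves the scratch cells 5 to 7, the output array 3
  and the table 4 free.\<close>

definition control :: "nat \<Rightarrow> nat \<Rightarrow> nat \<Rightarrow> store \<Rightarrow> bool" where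
  "control W i e s \<longleftrightarrow> s 0 0 = n \<and> s 0 1 = d \<and> s 0 2 = W \<and> s 0 3 = i \<and> s 0 4 = e \<and>
     (\<forall>c\<in>{1, 2}. s c = char_matrix n d (family c))"

lemma t_le: "t \<le> d"
proof (cases d)
  case (Suc d')
  obtain K' where K': "K = Suc K'" using K_pos by (cases K) auto
  have "d + (K - 1) \<le> d * K" by (simp add: Suc K')
  then have "t \<le> d * K div K" unfolding t by (rule div_le_mono)
  then show ?thesis using K_pos by simp
qed (use K_pos in \<open>simp add: t\<close>)

lemma d_le: "d \<le> t * K"
proof -
  have "d + (K - 1) < Suc t * K" using K_pos unfolding t
    by (metis div_less_iff_less_mult lessI)
  then show ?thesis by simp
qed

lemma exp_val_bit_exp:
  assumes "control W i e s" "s 0 5 = j" "c \<in> {1, 2}" "i < n"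
  shows "exp_val (bit_exp c l) s = of_bool (j * K + l < d \<and> Suc (j * K + l) \<in> family c ! i)"
proof (cases "j * K + l < d")
  case True
  have "i * d + (j * K + l) < (i + 1) * d" using True by simp
  also have "\<dots> \<le> n * d" using assms(4) by (intro mult_le_mono1) simp
  finally have "i * d + (j * K + l) < n * d" .
  moreover have "d - (j * K + l) \<ge> 1" using True by simp
  ultimately show ?thesis using assms True
    by (auto simp: bit_exp_def Let_def indicator_exp_def control_def char_matrix_def)
next
  case False
  then show ?thesis using assms by (auto simp: bit_exp_def Let_def indicator_exp_def control_def)
qed

lemma exp_val_block_exp:
  assumes "control W i e s" "s 0 5 = j" "c \<in> {1, 2}" "i < n"
  shows "exp_val (block_exp c k) s = set_encode {l. l < k \<and> j * K + l < d \<and> Suc (j * K + l) \<in> family c ! i}"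
proof (induction k)
  case (Suc k)
  have "{l. l < Suc k \<and> j * K + l < d \<and> Suc (j * K + l) \<in> family c ! i} =
      (if j * K + k < d \<and> Suc (j * K + k) \<in> family c ! i
       then insert k {l. l < k \<and> j * K + l < d \<and> Suc (j * K + l) \<in> family c ! i}
       else {l. l < k \<and> j * K + l < d \<and> Suc (j * K + l) \<in> family c ! i})"
    by (auto simp: less_Suc_eq)
  then show ?case using Suc exp_val_bit_exp[OF assms] by simp
qed simp

lemma exp_val_key_exp:
  assumes "control W i e s" "s 0 5 = j" "c \<in> {1, 2}" "i < n"
    and "s 0 6 = e div D ^ j" "s 0 7 = hkey c d (family c ! i) e j"
  shows "exp_val (key_exp c) s = hkey c d (family c ! i) e (Suc j)"
proof -
  define v where "v = block d (family c ! i) j"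
  define x where "x = e div D ^ j mod D"
  have v: "exp_val (block_exp c K) s = set_encode v"
    using exp_val_block_exp[OF assms(1-4)] by (simp add: v_def block_def)
  have dg: "exp_val digit_exp s = x"
    using assms by (simp add: digit_exp_def x_def minus_div_mult_eq_mod)
  have xD: "x < D" using D_pos by (simp add: x_def)
  have vK: "v \<subseteq> {..<K}" by (simp add: v_def block_subset)
  then have fv: "finite v" by (rule finite_subset) simp
  \<comment> \<open>The packed index lies in the range of the table, so the default value 0 of
    \<open>table_exp\<close> does not occur.\<close>
  have "set_encode v * D + x < Suc (set_encode v) * D" using xD by simp
  also have "\<dots> \<le> 2 ^ K * D" using set_encode_less[OF vK] by (intro mult_le_mono1) simp
  finally have "exp_val (table_exp (\<lambda>w. key c (set_decode (w div D)) (w mod D)) (2 ^ K * D)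
       (Bin Plus (Bin Times (block_exp c K) (Const D)) digit_exp)) s = key c v x"
    using xD fv by (simp add: exp_val_table_exp v dg)
  then show ?thesis using assms by (simp add: key_exp_def v_def x_def)
qed

lemma exp_val_blocks_exp: "s 0 1 = d \<Longrightarrow> exp_val blocks_exp s = t"
  by (simp add: blocks_exp_def t)

lemma control_frame:
  "control W i e s \<Longrightarrow> k > 4 \<Longrightarrow> control W i e (store_upd s 0 k v)"
  by (auto simp: control_def store_upd_def)

lemma store_upd_apply: "store_upd s x i v y k = (if y = x \<and> k = i then v else s y k)"
  by (simp add: store_upd_def)

lemma store_upd_other: "y \<noteq> x \<Longrightarrow> store_upd s x i v y = s y"
  by (simp add: store_upd_def)

lemma hkey_le_V:
  assumes "c \<in> {1, 2}" "j \<le> t"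
  shows "hkey c d a e j \<le> V"
proof -
  have "hkey c d a e j < m ^ j" using assms(1) by (rule hkey_less)
  also have "\<dots> \<le> m ^ t" using m_pos assms(2) by (intro power_increasing) auto
  also have "\<dots> \<le> V" by (rule V)
  finally show ?thesis by simp
qed

text \<open>The arbitrary \<open>Q\<close> carries any invariant on the output and the table across
  the computation of a key, which writes only to scratch cells.\<close>

lemma runs_key_prog:
  assumes c: "c \<in> {1, 2}" and i: "i < n" and e: "e \<le> V"
  shows "runs V ((t + 1) * L) (\<lambda>s. control W i e s \<and> Q (s 3) (s 4)) (key_prog c)
    (\<lambda>s. control W i e s \<and> Q (s 3) (s 4) \<and> s 0 7 = hkey c d (family c ! i) e t)"
proof -
  define I where "I j s \<longleftrightarrow> (control W i e s \<and> Q (s 3) (s 4)) \<and> s 0 5 = j \<and> s 0 6 = e div D ^ j \<and>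
    s 0 7 = hkey c d (family c ! i) e j" for j s
  have LX: "size_of_nat V \<le> (t + 1) * L" by (simp add: L)
  have loop: "runs V ((t + 1) * L) (I 0) (While (Bin Minus blocks_exp (scalar 5))
       (Seq (put 7 (key_exp c))
       (Seq (put 6 (Bin Divide (scalar 6) (Const D)))
         (put 5 (Bin Plus (scalar 5) (Const 1)))))) (I t)"
  proof (rule runs_While)
    fix j assume j: "j < t"
    show "runs V L (I j) (Seq (put 7 (key_exp c))
       (Seq (put 6 (Bin Divide (scalar 6) (Const D)))
         (put 5 (Bin Plus (scalar 5) (Const 1))))) (I (Suc j))"
    proof (rule runs_Seq, rule runs_Assign[where Post = "\<lambda>s. (control W i e s \<and> Q (s 3) (s 4)) \<and> s 0 5 = j \<and>
        s 0 6 = e div D ^ j \<and> s 0 7 = hkey c d (family c ! i) e (Suc j)"])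
      fix s assume s: "I j s"
      then have "exp_val (key_exp c) s = hkey c d (family c ! i) e (Suc j)"
        using exp_val_key_exp[of W i e s j c] c i by (simp add: I_def)
      moreover have "hkey c d (family c ! i) e (Suc j) \<le> V" using j by (intro hkey_le_V c) simp
      ultimately show "exp_val (key_exp c) s \<le> V \<and>
        (control W i e (store_upd s 0 (exp_val (Const 7) s) (exp_val (key_exp c) s)) \<and>
         Q (store_upd s 0 (exp_val (Const 7) s) (exp_val (key_exp c) s) 3)
           (store_upd s 0 (exp_val (Const 7) s) (exp_val (key_exp c) s) 4)) \<and>
        store_upd s 0 (exp_val (Const 7) s) (exp_val (key_exp c) s) 0 5 = j \<and>
        store_upd s 0 (exp_val (Const 7) s) (exp_val (key_exp c) s) 0 6 = e div D ^ j \<and>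
        store_upd s 0 (exp_val (Const 7) s) (exp_val (key_exp c) s) 0 7 = hkey c d (family c ! i) e (Suc j)"
        using s by (simp add: I_def control_frame store_upd_apply store_upd_other del: hkey.simps)
    next
      show "runs V L (\<lambda>s. (control W i e s \<and> Q (s 3) (s 4)) \<and> s 0 5 = j \<and> s 0 6 = e div D ^ j \<and>
          s 0 7 = hkey c d (family c ! i) e (Suc j))
        (Seq (put 6 (Bin Divide (scalar 6) (Const D))) (put 5 (Bin Plus (scalar 5) (Const 1)))) (I (Suc j))"
      proof (rule runs_Seq, rule runs_Assign[where Post = "\<lambda>s. (control W i e s \<and> Q (s 3) (s 4)) \<and> s 0 5 = j \<and>
          s 0 6 = e div D ^ Suc j \<and> s 0 7 = hkey c d (family c ! i) e (Suc j)"], goal_cases)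
        case (1 s)
        have "e div D ^ j div D = e div D ^ Suc j" by (simp only: power_Suc2 div_mult2_eq)
        moreover have "e div D ^ Suc j \<le> V" using e by (meson div_le_dividend order_trans)
        ultimately show ?case using 1
          by (simp add: control_frame store_upd_apply store_upd_other del: hkey.simps power_Suc)
      next
        case 3
        show ?case using j t_le V
          by (intro runs_Assign) (auto simp: I_def control_frame store_upd_apply store_upd_other L simp del: hkey.simps)
      qed (simp add: L)
    qed (simp add: L)
  next
    fix j s assume "I j s" "j \<le> t"
    then show "exp_val (Bin Minus blocks_exp (scalar 5)) s \<noteq> 0 \<longleftrightarrow> j < t"
      by (auto simp: I_def exp_val_blocks_exp control_def)
  qed (simp add: L)
  have 3: "runs V ((t + 1) * L) (\<lambda>s. (control W i e s \<and> Q (s 3) (s 4)) \<and> s 0 7 = 0 \<and> s 0 6 = e) (put 5 (Const 0)) (I 0)"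
    using LX by (intro runs_Assign) (auto simp: I_def control_frame store_upd_apply store_upd_other)
  have 2: "runs V ((t + 1) * L) (\<lambda>s. (control W i e s \<and> Q (s 3) (s 4)) \<and> s 0 7 = 0) (put 6 (scalar 4))
      (\<lambda>s. (control W i e s \<and> Q (s 3) (s 4)) \<and> s 0 7 = 0 \<and> s 0 6 = e)"
    using LX e by (intro runs_Assign) (auto simp: control_frame store_upd_apply store_upd_other control_def)
  have 1: "runs V ((t + 1) * L) (\<lambda>s. control W i e s \<and> Q (s 3) (s 4)) (put 7 (Const 0))
      (\<lambda>s. (control W i e s \<and> Q (s 3) (s 4)) \<and> s 0 7 = 0)"
    using LX by (intro runs_Assign) (auto simp: control_frame store_upd_apply store_upd_other)
  have "runs V ((t + 1) * L) (\<lambda>s. control W i e s \<and> Q (s 3) (s 4)) (key_prog c) (I t)"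
    unfolding key_prog_def by (intro runs_Seq[OF 1] runs_Seq[OF 2] runs_Seq[OF 3] loop)
  then show ?thesis by (rule runs_mono) (auto simp: I_def)
qed

lemma runs_power_prog:
  "runs V ((t + 1) * L) (\<lambda>s. control 0 0 0 s \<and> Q (s 3) (s 4)) power_prog
    (\<lambda>s. control (D ^ t) 0 0 s \<and> Q (s 3) (s 4))"
proof -
  define I where "I j s \<longleftrightarrow> (control (D ^ j) 0 0 s \<and> Q (s 3) (s 4)) \<and> s 0 5 = j" for j s
  have LX: "size_of_nat V \<le> (t + 1) * L" by (simp add: L)
  have W: "control W' i e (store_upd s 0 2 W')" if "control W i e s" for W W' i e s
    using that by (auto simp: control_def store_upd_def)
  have 1: "runs V ((t + 1) * L) (\<lambda>s. control 0 0 0 s \<and> Q (s 3) (s 4)) (put 2 (Const 1))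
      (\<lambda>s. control 1 0 0 s \<and> Q (s 3) (s 4))"
    using LX V by (intro runs_Assign) (auto simp: store_upd_other intro: W)
  have 2: "runs V ((t + 1) * L) (\<lambda>s. control 1 0 0 s \<and> Q (s 3) (s 4)) (put 5 (Const 0)) (I 0)"
    using LX by (intro runs_Assign) (auto simp: I_def control_frame store_upd_apply store_upd_other)
  have loop: "runs V ((t + 1) * L) (I 0) (While (Bin Minus blocks_exp (scalar 5))
       (Seq (put 2 (Bin Times (scalar 2) (Const D)))
         (put 5 (Bin Plus (scalar 5) (Const 1))))) (I t)"
  proof (rule runs_While)
    fix j assume j: "j < t"
    have "D ^ Suc j \<le> D ^ t" using D_pos j by (intro power_increasing) auto
    then have Dj: "D ^ Suc j \<le> V" using V by linarith
    have "runs V L (I j) (put 2 (Bin Times (scalar 2) (Const D)))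
        (\<lambda>s. (control (D ^ Suc j) 0 0 s \<and> Q (s 3) (s 4)) \<and> s 0 5 = j)"
    proof (rule runs_Assign)
      fix s assume s: "I j s"
      then have "exp_val (Bin Times (scalar 2) (Const D)) s = D ^ Suc j"
        by (simp add: I_def control_def)
      then show "exp_val (Bin Times (scalar 2) (Const D)) s \<le> V \<and>
          (control (D ^ Suc j) 0 0 (store_upd s 0 (exp_val (Const 2) s) (exp_val (Bin Times (scalar 2) (Const D)) s)) \<and>
           Q (store_upd s 0 (exp_val (Const 2) s) (exp_val (Bin Times (scalar 2) (Const D)) s) 3)
             (store_upd s 0 (exp_val (Const 2) s) (exp_val (Bin Times (scalar 2) (Const D)) s) 4)) \<and>
          store_upd s 0 (exp_val (Const 2) s) (exp_val (Bin Times (scalar 2) (Const D)) s) 0 5 = j"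
        using s Dj W[of "D ^ j" 0 0 s "D ^ Suc j"]
        by (simp add: I_def store_upd_apply store_upd_other del: power_Suc)
    qed (simp add: L)
    moreover have "runs V L (\<lambda>s. (control (D ^ Suc j) 0 0 s \<and> Q (s 3) (s 4)) \<and> s 0 5 = j)
        (put 5 (Bin Plus (scalar 5) (Const 1))) (I (Suc j))"
      using j t_le V
      by (intro runs_Assign) (auto simp: I_def control_frame store_upd_apply store_upd_other L simp del: power_Suc)
    ultimately show "runs V L (I j) (Seq (put 2 (Bin Times (scalar 2) (Const D)))
         (put 5 (Bin Plus (scalar 5) (Const 1)))) (I (Suc j))" by (rule runs_Seq)
  next
    fix j s assume "I j s" "j \<le> t"
    then show "exp_val (Bin Minus blocks_exp (scalar 5)) s \<noteq> 0 \<longleftrightarrow> j < t"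
      by (auto simp: I_def exp_val_blocks_exp control_def)
  qed (simp add: L)
  have "runs V ((t + 1) * L) (\<lambda>s. control 0 0 0 s \<and> Q (s 3) (s 4)) power_prog (I t)"
    unfolding power_prog_def by (intro runs_Seq[OF 1] runs_Seq[OF 2] loop)
  then show ?thesis by (rule runs_mono) (auto simp: I_def)
qed

text \<open>Shared by both passes: \<open>J i e\<close> is the invariant on output and table once
  all keys of the first \<open>i\<close> members and the first \<open>e\<close> keys of member
  \<open>i\<close> are treated. The initial member and key index are arbitrary, because the second
  pass starts with leftovers of the first.\<close>

lemma runs_scan:
  assumes c: "c \<in> {1, 2}"
    and act: "\<And>i e. i < n \<Longrightarrow> e < D ^ t \<Longrightarrow>
      runs V L (\<lambda>s. control (D ^ t) i e s \<and> J i e (s 3) (s 4) \<and> s 0 7 = hkey c d (family c ! i) e t)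
        act (\<lambda>s. control (D ^ t) i e s \<and> J i (Suc e) (s 3) (s 4))"
    and next_row: "\<And>i r u. i < n \<Longrightarrow> J i (D ^ t) r u \<Longrightarrow> J (Suc i) 0 r u"
  shows "runs V ((n + 1) * ((D ^ t + 1) * ((t + 1) * L)))
    (\<lambda>s. (\<exists>i e. control (D ^ t) i e s) \<and> J 0 0 (s 3) (s 4)) (scan c act)
    (\<lambda>s. (\<exists>i e. control (D ^ t) i e s) \<and> J n 0 (s 3) (s 4))"
proof -
  define X where "X = (t + 1) * L"
  define Y where "Y = (D ^ t + 1) * X"
  have LX: "L \<le> X" "X \<le> Y" by (simp_all add: X_def Y_def)
  have upd3: "control W i' e (store_upd s 0 3 i')" if "control W i e s" for W i i' e s
    using that by (auto simp: control_def store_upd_def)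
  have upd4: "control W i e' (store_upd s 0 4 e')" if "control W i e s" for W i e e' s
    using that by (auto simp: control_def store_upd_def)
  define I where "I i s \<longleftrightarrow> (\<exists>e. control (D ^ t) i e s) \<and> J i 0 (s 3) (s 4)" for i s
  have row: "runs V Y (I i) (Seq (Seq (put 4 (Const 0))
         (While (Bin Minus (scalar 2) (scalar 4))
           (Seq (key_prog c) (Seq act (put 4 (Bin Plus (scalar 4) (Const 1)))))))
       (put 3 (Bin Plus (scalar 3) (Const 1)))) (I (Suc i))" if i: "i < n" for i
  proof -
    define I' where "I' e s \<longleftrightarrow> control (D ^ t) i e s \<and> J i e (s 3) (s 4)" for e s
    have step: "runs V X (I' e) (Seq (key_prog c) (Seq act (put 4 (Bin Plus (scalar 4) (Const 1))))) (I' (Suc e))"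
      if e: "e < D ^ t" for e
    proof (rule runs_Seq)
      show "runs V X (I' e) (key_prog c)
          (\<lambda>s. control (D ^ t) i e s \<and> J i e (s 3) (s 4) \<and> s 0 7 = hkey c d (family c ! i) e t)"
        using runs_key_prog[of c i e "D ^ t" "J i e"] c i e V by (simp add: I'_def[abs_def] X_def)
      show "runs V X (\<lambda>s. control (D ^ t) i e s \<and> J i e (s 3) (s 4) \<and> s 0 7 = hkey c d (family c ! i) e t)
          (Seq act (put 4 (Bin Plus (scalar 4) (Const 1)))) (I' (Suc e))"
      proof (rule runs_Seq)
        show "runs V X (\<lambda>s. control (D ^ t) i e s \<and> J i e (s 3) (s 4) \<and> s 0 7 = hkey c d (family c ! i) e t)
          act (\<lambda>s. control (D ^ t) i e s \<and> J i (Suc e) (s 3) (s 4))"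
          by (rule runs_mono[OF act[OF i e] LX(1)])
        show "runs V X (\<lambda>s. control (D ^ t) i e s \<and> J i (Suc e) (s 3) (s 4))
          (put 4 (Bin Plus (scalar 4) (Const 1))) (I' (Suc e))"
        proof (rule runs_Assign)
          fix s assume s: "control (D ^ t) i e s \<and> J i (Suc e) (s 3) (s 4)"
          then have "s 0 4 = e" by (simp add: control_def)
          then show "exp_val (Bin Plus (scalar 4) (Const 1)) s \<le> V \<and> I' (Suc e)
              (store_upd s 0 (exp_val (Const 4) s) (exp_val (Bin Plus (scalar 4) (Const 1)) s))"
            using s e V upd4[of "D ^ t" i e s "Suc e"] by (simp add: I'_def store_upd_other)
        qed (use LX L in simp)
      qed
    qed
    have loop: "runs V Y (I' 0) (While (Bin Minus (scalar 2) (scalar 4))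
           (Seq (key_prog c) (Seq act (put 4 (Bin Plus (scalar 4) (Const 1)))))) (I' (D ^ t))"
      unfolding Y_def
    proof (rule runs_While[where I = I'])
      show "exp_val (Bin Minus (scalar 2) (scalar 4)) s \<noteq> 0 \<longleftrightarrow> e < D ^ t" if "I' e s" for e s
        using that by (auto simp: I'_def control_def)
    qed (use step LX L in simp_all)
    have init: "runs V Y (I i) (put 4 (Const 0)) (I' 0)"
      using LX L by (intro runs_Assign) (auto simp: I_def I'_def store_upd_other intro: upd4)
    have incr: "runs V Y (I' (D ^ t)) (put 3 (Bin Plus (scalar 3) (Const 1))) (I (Suc i))"
    proof (rule runs_Assign)
      fix s assume s: "I' (D ^ t) s"
      then have "s 0 3 = i" by (simp add: I'_def control_def)
      then show "exp_val (Bin Plus (scalar 3) (Const 1)) s \<le> V \<and> I (Suc i)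
          (store_upd s 0 (exp_val (Const 3) s) (exp_val (Bin Plus (scalar 3) (Const 1)) s))"
        using s i V upd3[of "D ^ t" i "D ^ t" s "Suc i"] next_row[OF i]
        by (auto simp: I_def I'_def store_upd_other)
    qed (use LX L in simp)
    show ?thesis by (rule runs_Seq[OF runs_Seq[OF init loop] incr])
  qed
  have loop: "runs V ((n + 1) * Y) (I 0) (While (Bin Minus (scalar 0) (scalar 3))
       (Seq (Seq (put 4 (Const 0))
         (While (Bin Minus (scalar 2) (scalar 4))
           (Seq (key_prog c) (Seq act (put 4 (Bin Plus (scalar 4) (Const 1)))))))
       (put 3 (Bin Plus (scalar 3) (Const 1))))) (I n)"
  proof (rule runs_While[where I = I])
    show "exp_val (Bin Minus (scalar 0) (scalar 3)) s \<noteq> 0 \<longleftrightarrow> i < n" if "I i s" for i s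
      using that by (auto simp: I_def control_def)
  qed (use row LX L in simp_all)
  have Y': "Y \<le> (n + 1) * Y" by simp
  have init: "runs V ((n + 1) * Y) (\<lambda>s. (\<exists>i e. control (D ^ t) i e s) \<and> J 0 0 (s 3) (s 4)) (put 3 (Const 0)) (I 0)"
  proof (rule runs_Assign)
    show "size_of_nat V \<le> (n + 1) * Y" using LX L Y' by linarith
  qed (auto simp: I_def store_upd_other intro: upd3)
  have "runs V ((n + 1) * Y) (\<lambda>s. (\<exists>i e. control (D ^ t) i e s) \<and> J 0 0 (s 3) (s 4)) (scan c act) (I n)"
    unfolding scan_def by (rule runs_Seq[OF init loop])
  then show ?thesis unfolding X_def[symmetric] Y_def[symmetric]
    by (rule runs_mono) (auto simp: I_def)
qed

section \<open>Invariants of the storing pass and of the lookup pass\<close>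

definition processed :: "nat \<Rightarrow> nat \<Rightarrow> nat \<Rightarrow> nat \<Rightarrow> bool" where
  "processed i e i' e' \<longleftrightarrow> e' < D ^ t \<and> (i' < i \<or> i' = i \<and> e' < e)"

lemma processed_Suc: "e < D ^ t \<Longrightarrow> processed i (Suc e) i' e' \<longleftrightarrow> processed i e i' e' \<or> i' = i \<and> e' = e"
  by (auto simp: processed_def)

lemma processed_row: "processed (Suc i) 0 i' e' \<longleftrightarrow> processed i (D ^ t) i' e'"
  by (auto simp: processed_def)

text \<open>Several members may own a key and overwrite one another. Hence an entry is only required
  to name some owner, and a treated key only to have some entry.\<close>

definition table_ok :: "nat \<Rightarrow> nat \<Rightarrow> (nat \<Rightarrow> nat) \<Rightarrow> bool" where
  "table_ok i e u \<longleftrightarrow>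
     (\<forall>k. u k \<noteq> 0 \<longrightarrow> u k \<le> n \<and> (\<exists>e'<D ^ t. hkey 1 d (A ! (u k - 1)) e' t = k)) \<and>
     (\<forall>i' e'. processed i e i' e' \<longrightarrow> u (hkey 1 d (A ! i') e' t) \<noteq> 0)"

definition output_ok :: "nat \<Rightarrow> nat \<Rightarrow> (nat \<Rightarrow> nat) \<Rightarrow> (nat \<Rightarrow> nat) \<Rightarrow> bool" where
  "output_ok i e r u \<longleftrightarrow> table_ok n 0 u \<and>
     (r 0 \<noteq> 0 \<longrightarrow> orthogonal_pair A B (r 1, r 2)) \<and>
     (\<forall>i' e'. processed i e i' e' \<longrightarrow> u (hkey 2 d (B ! i') e' t) \<noteq> 0 \<longrightarrow> r 0 \<noteq> 0)"

lemma instance_rows: "i < n \<Longrightarrow> A ! i \<subseteq> {1..d}" "length A = n" "length B = n"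
  using inst by (auto simp: OV_instance_def)

lemma runs_store:
  "runs V ((n + 1) * ((D ^ t + 1) * ((t + 1) * L)))
    (\<lambda>s. (\<exists>i e. control (D ^ t) i e s) \<and> (s 3 = (\<lambda>_. 0) \<and> table_ok 0 0 (s 4))) (scan 1 store_prog)
    (\<lambda>s. (\<exists>i e. control (D ^ t) i e s) \<and> (s 3 = (\<lambda>_. 0) \<and> table_ok n 0 (s 4)))"
proof (rule runs_scan[where J = "\<lambda>i e r u. r = (\<lambda>_. 0) \<and> table_ok i e u"])
  fix i e assume ie: "i < n" "e < D ^ t"
  show "runs V L (\<lambda>s. control (D ^ t) i e s \<and> (s 3 = (\<lambda>_. 0) \<and> table_ok i e (s 4)) \<and> s 0 7 = hkey 1 d (family 1 ! i) e t)
      store_prog (\<lambda>s. control (D ^ t) i e s \<and> (s 3 = (\<lambda>_. 0) \<and> table_ok i (Suc e) (s 4)))"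
    unfolding store_prog_def
  proof (rule runs_Assign)
    fix s assume s: "control (D ^ t) i e s \<and> (s 3 = (\<lambda>_. 0) \<and> table_ok i e (s 4)) \<and> s 0 7 = hkey 1 d (family 1 ! i) e t"
    define h where "h = hkey 1 d (A ! i) e t"
    have vals: "s 0 7 = h" "s 0 3 = i" using s by (auto simp: h_def family_def control_def)
    have "control (D ^ t) i e (store_upd s 4 h (Suc i))"
      using s by (auto simp: control_def store_upd_def)
    moreover have "table_ok i (Suc e) ((s 4)(h := Suc i))"
    proof -
      have tab: "table_ok i e (s 4)" using s by simp
      show ?thesis unfolding table_ok_def processed_Suc[OF ie(2)]
        using tab ie by (auto simp: table_ok_def h_def)
    qed
    moreover have "store_upd s 4 h (Suc i) 4 = (s 4)(h := Suc i)" by (simp add: store_upd_def)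
    ultimately show "exp_val (Bin Plus (scalar 3) (Const 1)) s \<le> V \<and>
        control (D ^ t) i e (store_upd s 4 (exp_val (scalar 7) s) (exp_val (Bin Plus (scalar 3) (Const 1)) s)) \<and>
        store_upd s 4 (exp_val (scalar 7) s) (exp_val (Bin Plus (scalar 3) (Const 1)) s) 3 = (\<lambda>_. 0) \<and>
        table_ok i (Suc e) (store_upd s 4 (exp_val (scalar 7) s) (exp_val (Bin Plus (scalar 3) (Const 1)) s) 4)"
      using s ie V by (simp add: vals store_upd_other)
  qed (simp add: L)
next
  fix i r u assume "i < n" "r = (\<lambda>_. 0) \<and> table_ok i (D ^ t) u"
  then show "r = (\<lambda>_. 0) \<and> table_ok (Suc i) 0 u" by (simp add: table_ok_def processed_row)
qed simp

lemma runs_lookup: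
  "runs V ((n + 1) * ((D ^ t + 1) * ((t + 1) * L)))
    (\<lambda>s. (\<exists>i e. control (D ^ t) i e s) \<and> output_ok 0 0 (s 3) (s 4)) (scan 2 lookup_prog)
    (\<lambda>s. (\<exists>i e. control (D ^ t) i e s) \<and> output_ok n 0 (s 3) (s 4))"
proof (rule runs_scan[where J = output_ok])
  fix i e assume ie: "i < n" "e < D ^ t"
  define h where "h = hkey 2 d (B ! i) e t"
  define Pre where "Pre s \<longleftrightarrow> control (D ^ t) i e s \<and> output_ok i e (s 3) (s 4) \<and> s 0 7 = h" for s
  define Post where "Post s \<longleftrightarrow> control (D ^ t) i e s \<and> output_ok i (Suc e) (s 3) (s 4)" for s
  define G where "G s \<longleftrightarrow> control (D ^ t) i e s \<and> table_ok n 0 (s 4) \<and> s 0 7 = h \<and> s 4 h \<noteq> 0" for s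
  have frame: "control (D ^ t) i e (store_upd s 3 k v)" if "control (D ^ t) i e s" for s k v
    using that by (auto simp: control_def store_upd_def)
  have G: "G (store_upd s 3 k v)" if "G s" for s k v
    using that frame[of s k v] by (auto simp: G_def store_upd_other)
  have "runs V L Pre lookup_prog Post" unfolding lookup_prog_def
  proof (rule runs_If)
    have 1: "runs V L (\<lambda>s. Pre s \<and> exp_val (Load 4 (scalar 7)) s \<noteq> 0)
        (Assign 3 (Const 1) (Bin Minus (Load 4 (scalar 7)) (Const 1)))
        (\<lambda>s. G s \<and> s 3 1 = s 4 h - 1)"
    proof (rule runs_Assign)
      fix s assume s: "Pre s \<and> exp_val (Load 4 (scalar 7)) s \<noteq> 0" "\<forall>x i. s x i \<le> V"
      then have "G s" "s 0 7 = h" by (auto simp: Pre_def G_def output_ok_def)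
      moreover have "s 4 h - 1 \<le> V" using s(2) by (meson diff_le_self order_trans)
      ultimately show "exp_val (Bin Minus (Load 4 (scalar 7)) (Const 1)) s \<le> V \<and>
          G (store_upd s 3 (exp_val (Const 1) s) (exp_val (Bin Minus (Load 4 (scalar 7)) (Const 1)) s)) \<and>
          store_upd s 3 (exp_val (Const 1) s) (exp_val (Bin Minus (Load 4 (scalar 7)) (Const 1)) s) 3 1 =
          store_upd s 3 (exp_val (Const 1) s) (exp_val (Bin Minus (Load 4 (scalar 7)) (Const 1)) s) 4 h - 1"
        by (simp add: G) (simp add: store_upd_def)
    qed (simp add: L)
    have 2: "runs V L (\<lambda>s. G s \<and> s 3 1 = s 4 h - 1) (Assign 3 (Const 2) (scalar 3))
        (\<lambda>s. G s \<and> s 3 1 = s 4 h - 1 \<and> s 3 2 = i)"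
    proof (rule runs_Assign)
      fix s assume s: "G s \<and> s 3 1 = s 4 h - 1"
      then have "s 0 3 = i" by (simp add: G_def control_def)
      with s show "exp_val (scalar 3) s \<le> V \<and> G (store_upd s 3 (exp_val (Const 2) s) (exp_val (scalar 3) s)) \<and>
          store_upd s 3 (exp_val (Const 2) s) (exp_val (scalar 3) s) 3 1 =
            store_upd s 3 (exp_val (Const 2) s) (exp_val (scalar 3) s) 4 h - 1 \<and>
          store_upd s 3 (exp_val (Const 2) s) (exp_val (scalar 3) s) 3 2 = i"
        using ie V by (simp add: G) (simp add: store_upd_def)
    qed (simp add: L)
    have 3: "runs V L (\<lambda>s. G s \<and> s 3 1 = s 4 h - 1 \<and> s 3 2 = i) (Assign 3 (Const 0) (Const 1)) Post"
    proof (rule runs_Assign)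
      fix s assume s: "G s \<and> s 3 1 = s 4 h - 1 \<and> s 3 2 = i"
      \<comment> \<open>Entries are shifted by one, so \<open>x\<close> is the position in
        \<open>A\<close>. Its owner shares the key \<open>h\<close> with \<open>B ! i\<close>, which
        forces the two sets to be disjoint.\<close>
      define x where "x = s 4 h - 1"
      have tab: "table_ok n 0 (s 4)" and ne: "s 4 h \<noteq> 0" using s by (auto simp: G_def)
      then obtain e' where x: "x < n" and e': "e' < D ^ t" "hkey 1 d (A ! x) e' t = h"
        unfolding table_ok_def x_def by fastforce
      have "A ! x \<inter> B ! i = {}"
        using disjoint_iff_hkey[OF instance_rows(1)[OF x] d_le] e' ie(2) unfolding h_def by blast
      then have "orthogonal_pair A B (x, i)"
        using x ie(1) instance_rows by (simp add: orthogonal_pair_def)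
      then have "output_ok i (Suc e) ((s 3)(0 := 1)) (s 4)"
        using tab s unfolding output_ok_def by (simp add: x_def)
      moreover have "control (D ^ t) i e (store_upd s 3 0 1)" using s frame by (simp add: G_def)
      ultimately show "exp_val (Const 1) s \<le> V \<and> Post (store_upd s 3 (exp_val (Const 0) s) (exp_val (Const 1) s))"
        using V by (simp add: Post_def) (simp add: store_upd_def)
    qed (simp add: L)
    show "runs V L (\<lambda>s. Pre s \<and> exp_val (Load 4 (scalar 7)) s \<noteq> 0)
      (Seq (Assign 3 (Const 1) (Bin Minus (Load 4 (scalar 7)) (Const 1)))
        (Seq (Assign 3 (Const 2) (scalar 3)) (Assign 3 (Const 0) (Const 1)))) Post"
      by (rule runs_Seq[OF 1 runs_Seq[OF 2 3]])
    show "runs V L (\<lambda>s. Pre s \<and> exp_val (Load 4 (scalar 7)) s = 0) Skip Post"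
    proof (rule runs_Skip)
      fix s assume s: "Pre s \<and> exp_val (Load 4 (scalar 7)) s = 0"
      then have z: "s 4 h = 0" by (auto simp: Pre_def)
      show "Post s" unfolding Post_def output_ok_def processed_Suc[OF ie(2)]
        using s z by (auto simp: Pre_def output_ok_def h_def)
    qed (simp add: L)
  qed (simp add: L)
  then show "runs V L (\<lambda>s. control (D ^ t) i e s \<and> output_ok i e (s 3) (s 4) \<and> s 0 7 = hkey 2 d (family 2 ! i) e t)
      lookup_prog (\<lambda>s. control (D ^ t) i e s \<and> output_ok i (Suc e) (s 3) (s 4))"
    by (simp add: Pre_def[abs_def] Post_def[abs_def] h_def family_def)
next
  fix i r u assume "i < n" "output_ok i (D ^ t) r u"
  then show "output_ok (Suc i) 0 r u" by (simp add: output_ok_def processed_row)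
qed simp

lemma runs_ov_prog:
  "runs V ((n + 1) * ((D ^ t + 1) * ((t + 1) * L))) (\<lambda>s. s = OV_input n d A B) ov_prog
    (\<lambda>s. (\<forall>ij. OV_output s = Some ij \<longrightarrow> orthogonal_pair A B ij) \<and>
       (has_orthogonal_pair A B \<longrightarrow> OV_output s \<noteq> None))"
proof -
  define X where "X = (n + 1) * ((D ^ t + 1) * ((t + 1) * L))"
  have "(t + 1) * L \<le> (n + 1) * (D ^ t + 1) * ((t + 1) * L)" by simp
  then have X: "(t + 1) * L \<le> X" by (simp only: X_def mult.assoc)
  have "runs V X (\<lambda>s. s = OV_input n d A B) ov_prog
    (\<lambda>s. (\<exists>i e. control (D ^ t) i e s) \<and> output_ok n 0 (s 3) (s 4))"
    unfolding ov_prog_def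
  proof (rule runs_Seq[OF _ runs_Seq])
    show "runs V X (\<lambda>s. s = OV_input n d A B) power_prog
        (\<lambda>s. (\<exists>i e. control (D ^ t) i e s) \<and> (s 3 = (\<lambda>_. 0) \<and> table_ok 0 0 (s 4)))"
      by (rule runs_mono[OF runs_power_prog[of "\<lambda>r u. r = (\<lambda>_. 0) \<and> u = (\<lambda>_. 0)"] X])
        (auto simp: OV_input_def control_def family_def table_ok_def processed_def)
    show "runs V X (\<lambda>s. (\<exists>i e. control (D ^ t) i e s) \<and> (s 3 = (\<lambda>_. 0) \<and> table_ok 0 0 (s 4)))
        (scan 1 store_prog) (\<lambda>s. (\<exists>i e. control (D ^ t) i e s) \<and> output_ok 0 0 (s 3) (s 4))"
      unfolding X_def
      by (rule runs_mono[OF runs_store order_refl]) (auto simp: output_ok_def processed_def)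
    show "runs V X (\<lambda>s. (\<exists>i e. control (D ^ t) i e s) \<and> output_ok 0 0 (s 3) (s 4))
        (scan 2 lookup_prog) (\<lambda>s. (\<exists>i e. control (D ^ t) i e s) \<and> output_ok n 0 (s 3) (s 4))"
      unfolding X_def by (rule runs_lookup)
  qed
  then show ?thesis unfolding X_def[symmetric]
  proof (rule runs_mono)
    fix s assume "(\<exists>i e. control (D ^ t) i e s) \<and> output_ok n 0 (s 3) (s 4)"
    then have ok: "output_ok n 0 (s 3) (s 4)" by simp
    have "OV_output s \<noteq> None" if "has_orthogonal_pair A B"
    proof -
      from that obtain i j where ij: "i < n" "j < n" "A ! i \<inter> B ! j = {}"
        using instance_rows by (metis has_orthogonal_pair_def in_set_conv_nth)
      then obtain e f where ef: "e < D ^ t" "f < D ^ t" "hkey 1 d (A ! i) e t = hkey 2 d (B ! j) f t"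
        using disjoint_iff_hkey[OF instance_rows(1)[OF ij(1)] d_le] by blast
      have "processed n 0 i e" "processed n 0 j f" using ij ef by (auto simp: processed_def)
      then have "s 3 0 \<noteq> 0" using ok ef(3) unfolding output_ok_def table_ok_def by metis
      then show ?thesis by (simp add: OV_output_def)
    qed
    then show "(\<forall>ij. OV_output s = Some ij \<longrightarrow> orthogonal_pair A B ij) \<and>
       (has_orthogonal_pair A B \<longrightarrow> OV_output s \<noteq> None)"
      using ok by (auto simp: OV_output_def output_ok_def)
  qed auto
qed

end

section \<open>Asymptotic running time\<close>

lemma measure_coins_UNIV: "measure coins UNIV = 1"
proof -
  interpret prob_space coins
    unfolding coins_def by (intro prob_space_PiM) (rule measure_pmf.prob_space_axioms)
  have "space coins = UNIV" by (simp add: coins_def space_PiM)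
  then show ?thesis using prob_space by simp
qed

lemma size_of_nat_less_power: "x < 2 ^ q \<Longrightarrow> size_of_nat x \<le> q + 1"
  using floorlog_leI[of x 2 q] by (simp add: size_of_nat_def)

text \<open>Bounding \<open>x ^ t\<close> by \<open>2 ^ (x * d)\<close> is crude, but
  \<open>D\<close> and \<open>m\<close> are constants, so the bit length remains linear in
  \<open>log n\<close> and \<open>d\<close>.\<close>

lemma size_of_nat_sum_le:
  assumes "t \<le> d"
  shows "size_of_nat (n + d + D ^ t + m ^ t + b + 2) \<le> floorlog 2 n + (1 + D + m) * d + b + 5"
proof (rule le_trans[OF size_of_nat_less_power])
  define Q where "Q = floorlog 2 n + (1 + D + m) * d + b + 1"
  have pow: "x ^ t \<le> 2 ^ (x * d)" for x :: nat
  proof -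
    have "x ^ t \<le> (2 ^ x) ^ t" by (intro power_mono) (auto intro: less_imp_le)
    also have "\<dots> = 2 ^ (x * t)" by (simp add: power_mult)
    also have "\<dots> \<le> 2 ^ (x * d)" using assms by (intro power_increasing) auto
    finally show ?thesis .
  qed
  have up: "2 ^ k \<le> (2::nat) ^ Q" if "k \<le> Q" for k using that by (intro power_increasing) auto
  have "n < 2 ^ floorlog 2 n" by (rule floorlog_leD) auto
  moreover have "2 ^ floorlog 2 n \<le> (2::nat) ^ Q" by (rule up) (simp add: Q_def)
  moreover have "d < 2 ^ d" "b < 2 ^ b" by simp_all
  moreover have "2 ^ d \<le> (2::nat) ^ Q" by (rule up) (simp add: Q_def algebra_simps)
  moreover have "2 ^ (D * d) \<le> (2::nat) ^ Q" by (rule up) (simp add: Q_def algebra_simps)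
  moreover have "2 ^ (m * d) \<le> (2::nat) ^ Q" by (rule up) (simp add: Q_def algebra_simps)
  moreover have "2 ^ b \<le> (2::nat) ^ Q" by (rule up) (simp add: Q_def)
  moreover have "2 ^ 1 \<le> (2::nat) ^ Q" by (rule up) (simp add: Q_def)
  \<comment> \<open>Six summands of at most \<open>2 ^ Q\<close> each.\<close>
  ultimately have "n + d + D ^ t + m ^ t + b + 2 < 8 * 2 ^ Q" using pow[of D] pow[of m] by linarith
  then show "n + d + D ^ t + m ^ t + b + 2 < 2 ^ (Q + 3)" by (simp add: power_add)
  show "Q + 3 + 1 \<le> floorlog 2 n + (1 + D + m) * d + b + 5" by (simp add: Q_def)
qed

lemma floorlog_le_log: "0 < n \<Longrightarrow> real (floorlog 2 n) \<le> log 2 n + 1"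
proof -
  assume "0 < n"
  then have "0 \<le> log 2 (real n)" by simp
  with \<open>0 < n\<close> show ?thesis by (simp add: floorlog_def)
qed

context disjointness_code
begin

text \<open>The 4 comes from \<open>n + 1 \<le> 2 * n\<close> and from absorbing the 1 in
  \<open>D ^ t + 1\<close>; \<open>1.25 ^ K\<close> pays for rounding the number of blocks up. The
  factor \<open>d n + 1\<close> bounds \<open>t + 1\<close>, and the last factor bounds
  \<open>size_of_nat V\<close>.\<close>

definition time_bound :: "(nat \<Rightarrow> nat) \<Rightarrow> nat \<Rightarrow> real" where
  "time_bound d n = real (prog_weight ov_prog) * (4 * 1.25 ^ K) * (1.25 ^ d n * real n) * (real (d n) + 1) *
     (log 2 (real n) + real (1 + D + m) * real (d n) + real (prog_bound ov_prog) + 6)"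

lemma time_bound_soft_O:
  assumes c: "c > 0" and d: "dimension_c_log c d"
  shows "time_bound d \<in> soft_O (\<lambda>n. 1.25 ^ d n * real n)"
proof -
  define C0 where "C0 = real (prog_weight ov_prog) * (4 * 1.25 ^ K)"
  define C1 where "C1 = real (1 + D + m)"
  define C2 where "C2 = real (prog_bound ov_prog) + 6"
  \<comment> \<open>Two factors of \<open>time_bound\<close> are logarithmic, the number of blocks
    and the bit length, hence the exponent 2; \<open>(ln 2) ^ 2\<close> changes the base. Constants
    are absorbed using \<open>1 \<le> l\<close>, valid from \<open>n = 2\<close> on.\<close>
  define E where "E = C0 * (c + 2) * (1 + C1 * (c + 1) + C2) / (ln 2) ^ 2"
  have nn: "C0 \<ge> 0" "C1 \<ge> 0" "C2 \<ge> 0" by (simp_all add: C0_def C1_def C2_def)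
  have "eventually (\<lambda>n. norm (time_bound d n) \<le> E * norm (1.25 ^ d n * real n * ln (real n) ^ 2)) at_top"
    using eventually_ge_at_top[of 2]
  proof eventually_elim
    case (elim n)
    define l where "l = log 2 (real n)"
    have l1: "1 \<le> l" using elim by (simp add: l_def)
    have dn: "real (d n) \<le> c * l + 1" 
      using d[unfolded dimension_c_log_def, rule_format, of n] elim unfolding l_def by linarith
    have a: "real (d n) + 1 \<le> (c + 2) * l" using dn l1 by (simp add: algebra_simps)
    have "C1 * real (d n) \<le> C1 * ((c + 1) * l)"
      using dn l1 nn by (intro mult_left_mono) (auto simp: algebra_simps)
    moreover have "C2 * 1 \<le> C2 * l" using l1 nn by (intro mult_left_mono) auto
    ultimately have b: "l + C1 * real (d n) + C2 \<le> (1 + C1 * (c + 1) + C2) * l"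
      by (simp add: algebra_simps)
    define g where "g = 1.25 ^ d n * real n"
    have g0: "g \<ge> 0" by (simp add: g_def)
    have b0: "0 \<le> l + C1 * real (d n) + C2" using l1 nn by simp
    have ab: "(real (d n) + 1) * (l + C1 * real (d n) + C2) \<le> ((c + 2) * l) * ((1 + C1 * (c + 1) + C2) * l)"
      using a b b0 c l1 by (intro mult_mono) auto
    have tb: "time_bound d n = C0 * g * ((real (d n) + 1) * (l + C1 * real (d n) + C2))"
      by (simp add: time_bound_def C0_def C1_def C2_def l_def g_def mult_ac add_ac)
    have "time_bound d n \<le> C0 * g * (((c + 2) * l) * ((1 + C1 * (c + 1) + C2) * l))"
      unfolding tb using ab nn g0 by (intro mult_left_mono) auto
    also have "\<dots> = E * (g * ln (real n) ^ 2)"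
      by (simp add: E_def l_def log_def power2_eq_square)
    also have "\<dots> = E * norm (g * ln (real n) ^ 2)" using g0 by (simp add: abs_mult)
    finally show ?case using tb nn g0 b0 unfolding g_def by (simp add: abs_of_nonneg)
  qed
  then have "time_bound d \<in> O(\<lambda>n. 1.25 ^ d n * real n * ln (real n) ^ 2)" by (rule bigoI)
  then show ?thesis unfolding soft_O_def by blast
qed

lemma ov_prog_correct:
  assumes n: "n > 0" and inst: "OV_instance n (d n) A B"
  shows "\<exists>T out. OV_run ov_prog \<omega> n (d n) A B T out \<and> real T \<le> time_bound d n \<and>
    (\<forall>ij. out = Some ij \<longrightarrow> orthogonal_pair A B ij) \<and> (has_orthogonal_pair A B \<longrightarrow> out \<noteq> None)"
proof -
  define t where "t = (d n + (K - 1)) div K"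
  define V where "V = n + d n + D ^ t + m ^ t + prog_bound ov_prog + 2"
  interpret ov_run K D m key n "d n" A B V "size_of_nat V" t
    using inst by unfold_locales (auto simp: V_def t_def)
  have init: "\<forall>x i. OV_input n (d n) A B x i \<le> V"
    by (auto simp: OV_input_def char_matrix_def V_def)
  obtain T s where run: "exec \<omega> ov_prog (OV_input n (d n) A B, 0) T (s, 0)"
    and T: "T \<le> prog_weight ov_prog * ((n + 1) * ((D ^ t + 1) * ((t + 1) * size_of_nat V)))"
    and out: "\<forall>ij. OV_output s = Some ij \<longrightarrow> orthogonal_pair A B ij"
      "has_orthogonal_pair A B \<longrightarrow> OV_output s \<noteq> None"
    using runsD[OF runs_ov_prog _ _ init, of \<omega> 0] by (auto simp: V_def)
  have "real D ^ t \<le> (1.25 ^ K) ^ t" using D_le by (intro power_mono) auto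
  also have "\<dots> = 1.25 ^ (K * t)" by (rule power_mult[symmetric])
  also have "\<dots> \<le> 1.25 ^ (K + d n)"
  proof (rule power_increasing)
    have "K * t \<le> d n + (K - 1)" unfolding t_def by (rule times_div_less_eq_dividend)
    then show "K * t \<le> K + d n" by simp
  qed simp
  finally have Dt: "real D ^ t + 1 \<le> 2 * (1.25 ^ K * 1.25 ^ d n)"
    using one_le_power[of "1.25 :: real" "K + d n"] by (simp add: power_add)
  have L: "real (size_of_nat V) \<le> log 2 (real n) + real (1 + D + m) * real (d n) + real (prog_bound ov_prog) + 6"
  proof -
    have "real (size_of_nat V) \<le> real (floorlog 2 n + (1 + D + m) * d n + prog_bound ov_prog + 5)"
      unfolding V_def by (intro of_nat_mono size_of_nat_sum_le t_le)
    then show ?thesis using floorlog_le_log[OF n] by (simp add: algebra_simps)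
  qed
  have "real T \<le> real (prog_weight ov_prog) * ((real n + 1) * ((real D ^ t + 1) * ((real t + 1) * real (size_of_nat V))))"
    using of_nat_mono[OF T, where 'a = real] by (simp add: algebra_simps)
  also have "\<dots> \<le> real (prog_weight ov_prog) * ((2 * real n) * (2 * (1.25 ^ K * 1.25 ^ d n) * ((real (d n) + 1) *
      (log 2 (real n) + real (1 + D + m) * real (d n) + real (prog_bound ov_prog) + 6))))"
    using n Dt L t_le by (intro mult_left_mono mult_mono) auto
  also have "\<dots> = time_bound d n" by (simp add: time_bound_def mult_ac)
  finally have "real T \<le> time_bound d n" .
  with run out show ?thesis unfolding OV_run_def by blast
qed

end

theorem theorem1p2:
  shows "\<exists>P :: prog. \<forall>c > 0. \<forall>d :: nat \<Rightarrow> nat. dimension_c_log c d \<longrightarrow>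
    (\<exists>(T :: nat \<Rightarrow> real) (\<epsilon> :: real).
      T \<in> soft_O (\<lambda>n. 1.25 ^ d n * real n) \<and> \<epsilon> > 0 \<and>
      (\<forall>n > 0. \<forall>A B. OV_instance n (d n) A B \<longrightarrow>
        (\<forall>\<omega>. \<exists>t out. OV_run P \<omega> n (d n) A B t out \<and> real t \<le> T n \<and>
           (\<forall>ij. out = Some ij \<longrightarrow> orthogonal_pair A B ij)) \<and>
        (has_orthogonal_pair A B \<longrightarrow>
           measure coins {\<omega>. \<exists>t ij. OV_run P \<omega> n (d n) A B t (Some ij)}
             \<ge> 1 - 2 powr - (real (d n) powr \<epsilon>))))"
proof -
  obtain K D m key where "disjointness_code K D m key"
    using exists_disjointness_code by blast
  then interpret disjointness_code K D m key .
  show ?thesis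
  proof (intro exI[of _ ov_prog] allI impI)
    fix c :: real and d :: "nat \<Rightarrow> nat"
    assume "c > 0" "dimension_c_log c d"
    then have T: "time_bound d \<in> soft_O (\<lambda>n. 1.25 ^ d n * real n)" by (rule time_bound_soft_O)
    show "\<exists>(T :: nat \<Rightarrow> real) (\<epsilon> :: real).
      T \<in> soft_O (\<lambda>n. 1.25 ^ d n * real n) \<and> \<epsilon> > 0 \<and>
      (\<forall>n > 0. \<forall>A B. OV_instance n (d n) A B \<longrightarrow>
        (\<forall>\<omega>. \<exists>t out. OV_run ov_prog \<omega> n (d n) A B t out \<and> real t \<le> T n \<and>
           (\<forall>ij. out = Some ij \<longrightarrow> orthogonal_pair A B ij)) \<and>
        (has_orthogonal_pair A B \<longrightarrow>
           measure coins {\<omega>. \<exists>t ij. OV_run ov_prog \<omega> n (d n) A B t (Some ij)}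
             \<ge> 1 - 2 powr - (real (d n) powr \<epsilon>)))"
    proof (rule exI[of _ "time_bound d"], rule exI[of _ 1], intro conjI T allI impI)
      fix n A B \<omega> assume "0 < n" "OV_instance n (d n) A B"
      from ov_prog_correct[of n d A B, OF this]
      \<comment> \<open>The pair is found for every coin sequence, so the success event is the whole
        space and any positive exponent, such as 1, will do.\<close>
      show "\<exists>t out. OV_run ov_prog \<omega> n (d n) A B t out \<and> real t \<le> time_bound d n \<and>
           (\<forall>ij. out = Some ij \<longrightarrow> orthogonal_pair A B ij)" by blast
    next
      fix n A B assume n: "0 < n" "OV_instance n (d n) A B" and "has_orthogonal_pair A B"
      then have "\<exists>t ij. OV_run ov_prog \<omega> n (d n) A B t (Some ij)" for \<omega>
        using ov_prog_correct[of n d A B \<omega>, OF n] by fastforce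
      then have "{\<omega>. \<exists>t ij. OV_run ov_prog \<omega> n (d n) A B t (Some ij)} = UNIV" by blast
      then show "1 - 2 powr - (real (d n) powr 1) \<le>
          measure coins {\<omega>. \<exists>t ij. OV_run ov_prog \<omega> n (d n) A B t (Some ij)}"
        by (simp add: measure_coins_UNIV)
    qed simp
  qed
qed

end
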